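(* $\mathsf{Span}_{\mathrm{az}}(\mathcal C,\mathcal S)$ is (a model of) the category $\mathcal C[\mathcal S^{-1}]$ of fractions with respect to the class $\mathcal S$, with localizing functor $\Phi_{\mathrm{az}}:\mathcal C\to\mathsf{Span}_{\mathrm{az}}(\mathcal C,\mathcal S)$, $f\mapsto[1,f]_{\mathrm{az}}$.
   Context: Standing assumptions: $\mathcal C$ is a category and $\mathcal S$ is a class of morphisms of $\mathcal C$ that contains all isomorphisms, is closed under composition, and is such that pullbacks of $\mathcal S$-morphisms along arbitrary morphisms exist in $\mathcal C$ and belong to $\mathcal S$. ($\mathcal S$ need not consist of monomorphisms, and hom-classes need not be small.) The category of fractions $\mathcal C[\mathcal S^{-1}]$ is characterized by its localizing functor $\mathcal C\to\mathcal C[\mathcal S^{-1}]$: it maps morphisms in $\mathcal S$ to isomorphisms, and every functor $F:\mathcal C\to\mathcal D$ mapping morphisms in $\mathcal S$ to isomorphisms factors uniquely through it. $\mathcal S$-spans: an $\mathcal S$-span $(s,f):A\to B$ is a pair $s:D\to A$ in $\mathcal S$, $f:D\to B$ in $\mathcal C$. A (vertical) morphism $x:(s,f)\to(\tilde s,\tilde f)$ of $\mathcal S$-spans from $A$ to $B$ is a $\mathcal C$-morphism $x$ with $\tilde s\cdot x=s$, $\tilde f\cdot x=f$. Isomorphic $\mathcal S$-spans are identified. $\mathsf{Span}(\mathcal C,\mathcal S)$ is the category with the objects of $\mathcal C$ and (isomorphism classes of) $\mathcal S$-spans as morphisms, with (horizontal) composition $(t,g)\cdot(s,f)=(s\cdot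 t',g\cdot f')$, where $f\cdot t'=t\cdot f'$ is a pullback square. A relation for $\mathcal S$-spans is compatible if it relates only $\mathcal S$-spans with the same domain and codomain, relates vertically isomorphic $\mathcal S$-spans, and is preserved by horizontal composition from either side. For a compatible equivalence relation $\sim$, $\mathsf{Span}_\sim(\mathcal C,\mathcal S)$ is the quotient category whose morphisms are the classes $[s,f]_\sim$. The relation $\sim_{\mathrm z}$: write $(s,f)\leqslant(\tilde s,\tilde f)$ iff there is a morphism $x:(s,f)\to(\tilde s,\tilde f)$ with $x\in\mathcal S$; $\sim_{\mathrm z}$ is the least equivalence relation containing $\leqslant$. The relation $\sim_{\mathrm a}$: an $\mathcal S$-cospan $\langle f,s\rangle:A\to B$ is (the isomorphism class of) a pair $f:A\to D$ in $\mathcal C$, $s:B\to D$ in $\mathcal S$; write $\langle f,s\rangle\preceq\langle\tilde f,\tilde s\rangle$ iff there is $v\in\mathcal S$ with $v\cdot f=\tilde f$, $v\cdot s=\tilde s$. $\mathrm{pb}\langle f,s\rangle:=(s',f')$ is the $\mathcal S$-span given by the pullback square $f\cdot s'=s\cdot f'$. $\approx_{\mathrm a}$ is the least compatible relation for $\mathcal S$-spans such that $\langle f,s\rangle\preceq\langle g,t\rangle$ implies $\mathrm{pb}\langle f,s\rangle\approx_{\mathrm a}\mathrm{pb}\langle g,t\rangle$, and $\sim_{\mathrm a}$ is the equivalence relation generated by $\approx_{\mathrm a}$. $\sim_{\mathrm{az}}$ is the least equivalence relation for $\mathcal S$-spans containing both $\sim_{\mathrm z}$ and $\sim_{\mathrm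 a}$ (it is compatible); $\mathsf{Span}_{\mathrm{az}}(\mathcal C,\mathcal S):=\mathsf{Span}_{\sim_{\mathrm{az}}}(\mathcal C,\mathcal S)$, with classes written $[s,f]_{\mathrm{az}}$. *)

theory Defs
  imports Main
begin

section \<open>Categories and functors\<close>

text \<open>Objects and morphisms are carrier sets inside arbitrary types. The function
  \<open>Comp\<close> is written in applicative order and is relevant only for composable arguments.\<close>

record ('o, 'm) cat =
  Obj :: "'o set"
  Mor :: "'m set"
  Src :: "'m \<Rightarrow> 'o"
  Tgt :: "'m \<Rightarrow> 'o"
  Ident :: "'o \<Rightarrow> 'm"
  Comp :: "'m \<Rightarrow> 'm \<Rightarrow> 'm"  (infixl "\<cdot>\<index>" 70)

definition Hom :: "('o, 'm) cat \<Rightarrow> 'o \<Rightarrow> 'o \<Rightarrow> 'm set" where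
  "Hom C A B = {f \<in> Mor C. Src C f = A \<and> Tgt C f = B}"

locale category =
  fixes C :: "('o, 'm) cat" (structure)
  assumes Src_in_Obj: "f \<in> Mor C \<Longrightarrow> Src C f \<in> Obj C"
    and Tgt_in_Obj: "f \<in> Mor C \<Longrightarrow> Tgt C f \<in> Obj C"
    and Ident_in_Hom: "A \<in> Obj C \<Longrightarrow> Ident C A \<in> Hom C A A"
    and Comp_in_Hom: "\<lbrakk>f \<in> Hom C A B; g \<in> Hom C B D\<rbrakk> \<Longrightarrow> g \<cdot> f \<in> Hom C A D"
    and Comp_Ident_right: "f \<in> Mor C \<Longrightarrow> f \<cdot> Ident C (Src C f) = f"
    and Comp_Ident_left: "f \<in> Mor C \<Longrightarrow> Ident C (Tgt C f) \<cdot> f = f"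
    and Comp_assoc: "\<lbrakk>f \<in> Hom C A B; g \<in> Hom C B D; h \<in> Hom C D E\<rbrakk>
                      \<Longrightarrow> (h \<cdot> g) \<cdot> f = h \<cdot> (g \<cdot> f)"

definition is_iso :: "('o, 'm) cat \<Rightarrow> 'm \<Rightarrow> bool" where
  "is_iso C f \<longleftrightarrow> f \<in> Mor C \<and>
     (\<exists>g \<in> Hom C (Tgt C f) (Src C f).
        g \<cdot>\<^bsub>C\<^esub> f = Ident C (Src C f) \<and> f \<cdot>\<^bsub>C\<^esub> g = Ident C (Tgt C f))"

record ('o, 'm, 'p, 'q) func =
  on_obj :: "'o \<Rightarrow> 'p"
  on_mor :: "'m \<Rightarrow> 'q"

definition is_functor ::
  "('o, 'm) cat \<Rightarrow> ('p, 'q) cat \<Rightarrow> ('o, 'm, 'p, 'q) func \<Rightarrow> bool" where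
  "is_functor C D F \<longleftrightarrow>
     (\<forall>A \<in> Obj C. on_obj F A \<in> Obj D) \<and>
     (\<forall>f \<in> Mor C. on_mor F f \<in> Hom D (on_obj F (Src C f)) (on_obj F (Tgt C f))) \<and>
     (\<forall>A \<in> Obj C. on_mor F (Ident C A) = Ident D (on_obj F A)) \<and>
     (\<forall>f \<in> Mor C. \<forall>g \<in> Mor C. Src C g = Tgt C f \<longrightarrow>
        on_mor F (g \<cdot>\<^bsub>C\<^esub> f) = on_mor F g \<cdot>\<^bsub>D\<^esub> on_mor F f)"

definition func_comp ::
  "('p, 'q, 'r, 's) func \<Rightarrow> ('o, 'm, 'p, 'q) func \<Rightarrow> ('o, 'm, 'r, 's) func" where
  "func_comp G F = \<lparr>on_obj = on_obj G \<circ> on_obj F, on_mor = on_mor G \<circ> on_mor F\<rparr>"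

text \<open>Equality of functors means agreement on the carriers of the source category; the
  values of the underlying HOL functions elsewhere are irrelevant.\<close>

definition func_eq ::
  "('o, 'm) cat \<Rightarrow> ('o, 'm, 'p, 'q) func \<Rightarrow> ('o, 'm, 'p, 'q) func \<Rightarrow> bool" where
  "func_eq C F G \<longleftrightarrow>
     (\<forall>A \<in> Obj C. on_obj F A = on_obj G A) \<and> (\<forall>f \<in> Mor C. on_mor F f = on_mor G f)"

definition inverts ::
  "'m set \<Rightarrow> ('p, 'q) cat \<Rightarrow> ('o, 'm, 'p, 'q) func \<Rightarrow> bool" where
  "inverts S D F \<longleftrightarrow> (\<forall>s \<in> S. is_iso D (on_mor F s))"

definition factors_uniquely ::
  "('o, 'm) cat \<Rightarrow> ('p, 'q) cat \<Rightarrow> ('o, 'm, 'p, 'q) func \<Rightarrow>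
   ('r, 's) cat \<Rightarrow> ('o, 'm, 'r, 's) func \<Rightarrow> bool" where
  "factors_uniquely C Q \<Phi> D F \<longleftrightarrow>
     (\<exists>G. is_functor Q D G \<and> func_eq C (func_comp G \<Phi>) F \<and>
        (\<forall>G'. is_functor Q D G' \<and> func_eq C (func_comp G' \<Phi>) F \<longrightarrow> func_eq Q G' G))"

text \<open>\<open>is_pullback C f g p q\<close>: the square \<open>f \<cdot> p = g \<cdot> q\<close> is a pullback, so that \<open>p\<close> is the
  pullback of \<open>g\<close> along \<open>f\<close>.\<close>

definition is_pullback :: "('o, 'm) cat \<Rightarrow> 'm \<Rightarrow> 'm \<Rightarrow> 'm \<Rightarrow> 'm \<Rightarrow> bool" where
  "is_pullback C f g p q \<longleftrightarrow>
     f \<in> Mor C \<and> g \<in> Mor C \<and> Tgt C f = Tgt C g \<and>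
     p \<in> Mor C \<and> q \<in> Mor C \<and> Src C p = Src C q \<and>
     Tgt C p = Src C f \<and> Tgt C q = Src C g \<and> f \<cdot>\<^bsub>C\<^esub> p = g \<cdot>\<^bsub>C\<^esub> q \<and>
     (\<forall>X. \<forall>a \<in> Hom C X (Src C f). \<forall>b \<in> Hom C X (Src C g). f \<cdot>\<^bsub>C\<^esub> a = g \<cdot>\<^bsub>C\<^esub> b \<longrightarrow>
        (\<exists>!h. h \<in> Hom C X (Src C p) \<and> p \<cdot>\<^bsub>C\<^esub> h = a \<and> q \<cdot>\<^bsub>C\<^esub> h = b))"

locale span_setting = category C for C :: "('o, 'm) cat" (structure) +
  fixes S :: "'m set"
  assumes S_subset: "S \<subseteq> Mor C"
    and iso_in_S: "is_iso C f \<Longrightarrow> f \<in> S"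
    and S_Comp: "\<lbrakk>s \<in> S; t \<in> S; Src C t = Tgt C s\<rbrakk> \<Longrightarrow> t \<cdot> s \<in> S"
    and pullback_exists: "\<lbrakk>s \<in> S; f \<in> Mor C; Tgt C f = Tgt C s\<rbrakk>
                           \<Longrightarrow> \<exists>p q. is_pullback C f s p q"
    and pullback_in_S: "\<lbrakk>s \<in> S; is_pullback C f s p q\<rbrakk> \<Longrightarrow> p \<in> S"

section \<open>Spans\<close>

definition Spans :: "('o, 'm) cat \<Rightarrow> 'm set \<Rightarrow> ('m \<times> 'm) set" where
  "Spans C S = {(s, f). s \<in> S \<and> f \<in> Mor C \<and> Src C s = Src C f}"

definition span_src :: "('o, 'm) cat \<Rightarrow> 'm \<times> 'm \<Rightarrow> 'o" where
  "span_src C u = Tgt C (fst u)"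

definition span_tgt :: "('o, 'm) cat \<Rightarrow> 'm \<times> 'm \<Rightarrow> 'o" where
  "span_tgt C u = Tgt C (snd u)"

definition parallel_spans :: "('o, 'm) cat \<Rightarrow> 'm set \<Rightarrow> (('m \<times> 'm) \<times> ('m \<times> 'm)) set" where
  "parallel_spans C S =
     {(u, v). u \<in> Spans C S \<and> v \<in> Spans C S \<and>
              span_src C u = span_src C v \<and> span_tgt C u = span_tgt C v}"

fun vertical :: "('o, 'm) cat \<Rightarrow> 'm \<Rightarrow> 'm \<times> 'm \<Rightarrow> 'm \<times> 'm \<Rightarrow> bool" where
  "vertical C x (s, f) (s', f') \<longleftrightarrow>
     x \<in> Hom C (Src C s) (Src C s') \<and> s' \<cdot>\<^bsub>C\<^esub> x = s \<and> f' \<cdot>\<^bsub>C\<^esub> x = f"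

definition span_iso :: "('o, 'm) cat \<Rightarrow> 'm set \<Rightarrow> (('m \<times> 'm) \<times> ('m \<times> 'm)) set" where
  "span_iso C S = {(u, v) \<in> parallel_spans C S. \<exists>x. is_iso C x \<and> vertical C x u v}"

text \<open>Pullbacks are determined only up to isomorphism. Working with representatives of
  isomorphism classes of spans, the composite \<open>(t, g) \<cdot> (s, f)\<close> is therefore the set of all
  spans arising from some choice of the pullback; it is empty if the spans do not match.\<close>

fun hcomp :: "('o, 'm) cat \<Rightarrow> 'm \<times> 'm \<Rightarrow> 'm \<times> 'm \<Rightarrow> ('m \<times> 'm) set" where
  "hcomp C (t, g) (s, f) = {(s \<cdot>\<^bsub>C\<^esub> t', g \<cdot>\<^bsub>C\<^esub> f') | t' f'. is_pullback C f t t' f'}"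

text \<open>Since all choices of pullbacks are admitted, and composites with identity spans are in
  particular all isomorphic copies of a span, a compatible relation on representatives is
  automatically a relation on isomorphism classes.\<close>

definition compatible :: "('o, 'm) cat \<Rightarrow> 'm set \<Rightarrow> (('m \<times> 'm) \<times> ('m \<times> 'm)) set \<Rightarrow> bool" where
  "compatible C S R \<longleftrightarrow>
     R \<subseteq> parallel_spans C S \<and> span_iso C S \<subseteq> R \<and>
     (\<forall>(u, v) \<in> R. \<forall>w \<in> Spans C S.
        (\<forall>p \<in> hcomp C w u. \<forall>q \<in> hcomp C w v. (p, q) \<in> R) \<and>
        (\<forall>p \<in> hcomp C u w. \<forall>q \<in> hcomp C v w. (p, q) \<in> R))"

text \<open>The quotient category for a compatible equivalence relation \<open>R\<close>, under which the union
  in \<open>Comp\<close> is the single class of the composite of any representatives.\<close>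

definition Span_quot ::
  "('o, 'm) cat \<Rightarrow> 'm set \<Rightarrow> (('m \<times> 'm) \<times> ('m \<times> 'm)) set \<Rightarrow> ('o, ('m \<times> 'm) set) cat" where
  "Span_quot C S R =
     \<lparr>Obj = Obj C,
      Mor = Spans C S // R,
      Src = (\<lambda>X. THE A. \<exists>u \<in> X. A = span_src C u),
      Tgt = (\<lambda>X. THE B. \<exists>u \<in> X. B = span_tgt C u),
      Ident = (\<lambda>A. R `` {(Ident C A, Ident C A)}),
      Comp = (\<lambda>Y X. \<Union>u \<in> X. \<Union>v \<in> Y. R `` hcomp C v u)\<rparr>"

definition Span_quot_functor ::
  "('o, 'm) cat \<Rightarrow> (('m \<times> 'm) \<times> ('m \<times> 'm)) set \<Rightarrow> ('o, 'm, 'o, ('m \<times> 'm) set) func" where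
  "Span_quot_functor C R =
     \<lparr>on_obj = (\<lambda>A. A), on_mor = (\<lambda>f. R `` {(Ident C (Src C f), f)})\<rparr>"

section \<open>The relations z, a and az\<close>

definition least_equiv :: "'a set \<Rightarrow> ('a \<times> 'a) set \<Rightarrow> ('a \<times> 'a) set" where
  "least_equiv A r = \<Inter>{R. equiv A R \<and> r \<subseteq> R}"

definition span_le :: "('o, 'm) cat \<Rightarrow> 'm set \<Rightarrow> (('m \<times> 'm) \<times> ('m \<times> 'm)) set" where
  "span_le C S = {(u, v) \<in> parallel_spans C S. \<exists>x \<in> S. vertical C x u v}"

definition sim_z :: "('o, 'm) cat \<Rightarrow> 'm set \<Rightarrow> (('m \<times> 'm) \<times> ('m \<times> 'm)) set" where
  "sim_z C S = least_equiv (Spans C S) (span_le C S)"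

definition Cospans :: "('o, 'm) cat \<Rightarrow> 'm set \<Rightarrow> ('m \<times> 'm) set" where
  "Cospans C S = {(f, s). f \<in> Mor C \<and> s \<in> S \<and> Tgt C f = Tgt C s}"

definition cospan_le :: "('o, 'm) cat \<Rightarrow> 'm set \<Rightarrow> (('m \<times> 'm) \<times> ('m \<times> 'm)) set" where
  "cospan_le C S =
     {((f, s), (g, t)). (f, s) \<in> Cospans C S \<and> (g, t) \<in> Cospans C S \<and>
        (\<exists>v \<in> S. Src C v = Tgt C f \<and> v \<cdot>\<^bsub>C\<^esub> f = g \<and> v \<cdot>\<^bsub>C\<^esub> s = t)}"

text \<open>All spans that arise from a cospan by some choice of the pullback.\<close>

fun pb :: "('o, 'm) cat \<Rightarrow> 'm \<times> 'm \<Rightarrow> ('m \<times> 'm) set" where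
  "pb C (f, s) = {(s', f'). is_pullback C f s s' f'}"

definition approx_a :: "('o, 'm) cat \<Rightarrow> 'm set \<Rightarrow> (('m \<times> 'm) \<times> ('m \<times> 'm)) set" where
  "approx_a C S =
     \<Inter>{R. compatible C S R \<and> (\<forall>(c, d) \<in> cospan_le C S. pb C c \<times> pb C d \<subseteq> R)}"

definition sim_a :: "('o, 'm) cat \<Rightarrow> 'm set \<Rightarrow> (('m \<times> 'm) \<times> ('m \<times> 'm)) set" where
  "sim_a C S = least_equiv (Spans C S) (approx_a C S)"

definition sim_az :: "('o, 'm) cat \<Rightarrow> 'm set \<Rightarrow> (('m \<times> 'm) \<times> ('m \<times> 'm)) set" where
  "sim_az C S = least_equiv (Spans C S) (sim_z C S \<union> sim_a C S)"

definition Span_az :: "('o, 'm) cat \<Rightarrow> 'm set \<Rightarrow> ('o, ('m \<times> 'm) set) cat" where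
  "Span_az C S = Span_quot C S (sim_az C S)"

definition Phi_az :: "('o, 'm) cat \<Rightarrow> 'm set \<Rightarrow> ('o, 'm, 'o, ('m \<times> 'm) set) func" where
  "Phi_az C S = Span_quot_functor C (sim_az C S)"

end

theory Submission
  imports Defs
begin

text \<open>Composition of spans is well defined modulo az because in the comparison of two pullbacks
  along \<open>f \<cdot> x\<close> and \<open>f\<close> with \<open>x \<in> S\<close> the induced morphism is itself a pullback of \<open>x\<close>, hence lies
  in \<open>S\<close>. For \<open>s \<in> S\<close>, the class of \<open>(s, 1)\<close> is inverse to that of \<open>(1, s)\<close>: one composite is
  \<open>(s, s)\<close>, which z relates to the identity, and the other is the kernel pair of \<open>s\<close>, which a
  relates to the identity via \<open>\<langle>1, 1\<rangle> \<preceq> \<langle>s, s\<rangle>\<close>. Conversely, for every functor \<open>F\<close> inverting \<open>S\<close>,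
  having equal values \<open>F f \<cdot> (F s)\<^sup>-\<^sup>1\<close> is an equivalence relation on spans that contains both
  z and a, and \<open>[s, f] = [1, f] \<cdot> [1, s]\<^sup>-\<^sup>1\<close> forces these values.\<close>

section \<open>Categories and isomorphisms\<close>

context category
begin

lemma Ident_Mor [simp]: "A \<in> Obj C \<Longrightarrow> Ident C A \<in> Mor C"
  and Src_Ident [simp]: "A \<in> Obj C \<Longrightarrow> Src C (Ident C A) = A"
  and Tgt_Ident [simp]: "A \<in> Obj C \<Longrightarrow> Tgt C (Ident C A) = A"
  using Ident_in_Hom[of A] by (auto simp: Hom_def)

lemma Comp_Mor [simp]: "\<lbrakk>f \<in> Mor C; g \<in> Mor C; Tgt C f = Src C g\<rbrakk> \<Longrightarrow> g \<cdot> f \<in> Mor C"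
  and Src_Comp [simp]: "\<lbrakk>f \<in> Mor C; g \<in> Mor C; Tgt C f = Src C g\<rbrakk> \<Longrightarrow> Src C (g \<cdot> f) = Src C f"
  and Tgt_Comp [simp]: "\<lbrakk>f \<in> Mor C; g \<in> Mor C; Tgt C f = Src C g\<rbrakk> \<Longrightarrow> Tgt C (g \<cdot> f) = Tgt C g"
  using Comp_in_Hom[of f "Src C f" "Tgt C f" g "Tgt C g"] by (auto simp: Hom_def)

lemma Comp_assoc':
  "\<lbrakk>f \<in> Mor C; g \<in> Mor C; h \<in> Mor C; Tgt C f = Src C g; Tgt C g = Src C h\<rbrakk>
   \<Longrightarrow> (h \<cdot> g) \<cdot> f = h \<cdot> (g \<cdot> f)"
  using Comp_assoc[of f "Src C f" "Tgt C f" g "Tgt C g" h "Tgt C h"] by (auto simp: Hom_def)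

lemma Comp_Ident_right' [simp]: "\<lbrakk>f \<in> Mor C; Src C f = A\<rbrakk> \<Longrightarrow> f \<cdot> Ident C A = f"
  using Comp_Ident_right by auto

lemma Comp_Ident_left' [simp]: "\<lbrakk>f \<in> Mor C; Tgt C f = A\<rbrakk> \<Longrightarrow> Ident C A \<cdot> f = f"
  using Comp_Ident_left by auto

lemma Src_Obj [simp]: "f \<in> Mor C \<Longrightarrow> Src C f \<in> Obj C"
  and Tgt_Obj [simp]: "f \<in> Mor C \<Longrightarrow> Tgt C f \<in> Obj C"
  by (auto intro: Src_in_Obj Tgt_in_Obj)

lemma is_isoI:
  "\<lbrakk>f \<in> Mor C; g \<in> Mor C; Src C g = Tgt C f; Tgt C g = Src C f;
    g \<cdot> f = Ident C (Src C f); f \<cdot> g = Ident C (Tgt C f)\<rbrakk> \<Longrightarrow> is_iso C f"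
  unfolding is_iso_def Hom_def by blast

text \<open>An inverse is picked by choice so that it can be used as a function in equations. For an
  isomorphism the choice is forced, by \<open>inv_mor_unique\<close>.\<close>

definition inv_mor :: "'m \<Rightarrow> 'm" where
  "inv_mor f = (SOME g. g \<in> Hom C (Tgt C f) (Src C f) \<and>
     g \<cdot> f = Ident C (Src C f) \<and> f \<cdot> g = Ident C (Tgt C f))"

lemma inv_mor_props:
  assumes "is_iso C f"
  shows "f \<in> Mor C" "inv_mor f \<in> Mor C" "Src C (inv_mor f) = Tgt C f" "Tgt C (inv_mor f) = Src C f"
    "inv_mor f \<cdot> f = Ident C (Src C f)" "f \<cdot> inv_mor f = Ident C (Tgt C f)"
proof -
  have "inv_mor f \<in> Hom C (Tgt C f) (Src C f) \<and>
     inv_mor f \<cdot> f = Ident C (Src C f) \<and> f \<cdot> inv_mor f = Ident C (Tgt C f)"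
    unfolding inv_mor_def by (rule someI_ex) (use assms in \<open>auto simp: is_iso_def\<close>)
  then show "inv_mor f \<in> Mor C" "Src C (inv_mor f) = Tgt C f" "Tgt C (inv_mor f) = Src C f"
    "inv_mor f \<cdot> f = Ident C (Src C f)" "f \<cdot> inv_mor f = Ident C (Tgt C f)"
    by (auto simp: Hom_def)
  show "f \<in> Mor C" using assms by (simp add: is_iso_def)
qed

text \<open>The trailing factor \<open>g\<close> makes the cancellation laws applicable inside
  composites that \<open>Comp_assoc'\<close> has bracketed to the right.\<close>

lemma inv_mor_cancel:
  assumes "is_iso C f" "g \<in> Mor C"
  shows "Tgt C g = Tgt C f \<Longrightarrow> f \<cdot> (inv_mor f \<cdot> g) = g"
    and "Tgt C g = Src C f \<Longrightarrow> inv_mor f \<cdot> (f \<cdot> g) = g"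
  using assms inv_mor_props[OF assms(1)] by (simp_all flip: Comp_assoc')

text \<open>Composing the equation \<open>f \<cdot> g = Ident C (Tgt C f)\<close> with
  \<open>inv_mor f\<close> on the left gives the claim. Once \<open>f\<close> is known to be
  invertible, a right inverse is thus enough to identify the inverse.\<close>

lemma inv_mor_unique:
  assumes "is_iso C f" "g \<in> Mor C" "Src C g = Tgt C f" "Tgt C g = Src C f" "f \<cdot> g = Ident C (Tgt C f)"
  shows "g = inv_mor f"
proof -
  note f = inv_mor_props[OF assms(1)]
  have "g = inv_mor f \<cdot> (f \<cdot> g)" using inv_mor_cancel(2)[OF assms(1,2,4)] by simp
  then show ?thesis using f assms(5) by simp
qed

lemma Ident_iso: "A \<in> Obj C \<Longrightarrow> is_iso C (Ident C A)"
  by (rule is_isoI[where g = "Ident C A"]) auto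

section \<open>Pullbacks\<close>

lemma is_pullbackD:
  assumes "is_pullback C f g p q"
  shows "f \<in> Mor C" "g \<in> Mor C" "p \<in> Mor C" "q \<in> Mor C" "Tgt C g = Tgt C f"
    "Src C q = Src C p" "Tgt C p = Src C f" "Tgt C q = Src C g"
  using assms by (auto simp: is_pullback_def)

lemma pullback_comm: "is_pullback C f g p q \<Longrightarrow> f \<cdot> p = g \<cdot> q"
  by (simp add: is_pullback_def)

lemma pullback_lift:
  assumes "is_pullback C f g p q"
    and "a \<in> Mor C" "b \<in> Mor C" "Src C b = Src C a" "Tgt C a = Src C f" "Tgt C b = Src C g"
    and "f \<cdot> a = g \<cdot> b"
  obtains h where "h \<in> Mor C" "Src C h = Src C a" "Tgt C h = Src C p" "p \<cdot> h = a" "q \<cdot> h = b"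
proof -
  have "a \<in> Hom C (Src C a) (Src C f)" "b \<in> Hom C (Src C a) (Src C g)"
    using assms by (auto simp: Hom_def)
  then have "\<exists>!h. h \<in> Hom C (Src C a) (Src C p) \<and> p \<cdot> h = a \<and> q \<cdot> h = b"
    using assms unfolding is_pullback_def by blast
  then show thesis using that by (auto simp: Hom_def)
qed

text \<open>The two legs of a pullback are jointly monic: \<open>h\<close> and \<open>k\<close> both
  mediate the cone \<open>p \<cdot> h\<close>, \<open>q \<cdot> h\<close>.\<close>

lemma pullback_cancel:
  assumes "is_pullback C f g p q"
    and "h \<in> Mor C" "k \<in> Mor C" "Src C k = Src C h" "Tgt C h = Src C p" "Tgt C k = Src C p"
    and "p \<cdot> h = p \<cdot> k" "q \<cdot> h = q \<cdot> k"
  shows "h = k"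
proof -
  note P = is_pullbackD[OF assms(1)]
  have "p \<cdot> h \<in> Hom C (Src C h) (Src C f)" "q \<cdot> h \<in> Hom C (Src C h) (Src C g)"
    using assms P by (auto simp: Hom_def)
  moreover have "f \<cdot> (p \<cdot> h) = g \<cdot> (q \<cdot> h)"
    using P assms(2-6) pullback_comm[OF assms(1)] by (simp flip: Comp_assoc')
  ultimately have "\<exists>!x. x \<in> Hom C (Src C h) (Src C p) \<and> p \<cdot> x = p \<cdot> h \<and> q \<cdot> x = q \<cdot> h"
    using assms(1) unfolding is_pullback_def by blast
  moreover have "h \<in> Hom C (Src C h) (Src C p)" "k \<in> Hom C (Src C h) (Src C p)"
    using assms by (auto simp: Hom_def)
  ultimately show ?thesis using assms(7,8) by metis
qed

text \<open>The unique existence is split into the existence of lifts and joint monicity of the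
  legs, which are proved by separate arguments below.\<close>

lemma is_pullbackI:
  assumes "f \<in> Mor C" "g \<in> Mor C" "p \<in> Mor C" "q \<in> Mor C" "Tgt C f = Tgt C g"
    "Src C p = Src C q" "Tgt C p = Src C f" "Tgt C q = Src C g" "f \<cdot> p = g \<cdot> q"
    and ex: "\<And>a b. \<lbrakk>a \<in> Mor C; b \<in> Mor C; Src C b = Src C a; Tgt C a = Src C f; Tgt C b = Src C g;
          f \<cdot> a = g \<cdot> b\<rbrakk>
        \<Longrightarrow> \<exists>h \<in> Mor C. Src C h = Src C a \<and> Tgt C h = Src C p \<and> p \<cdot> h = a \<and> q \<cdot> h = b"
    and un: "\<And>h k. \<lbrakk>h \<in> Mor C; k \<in> Mor C; Src C k = Src C h; Tgt C h = Src C p; Tgt C k = Src C p;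
          p \<cdot> h = p \<cdot> k; q \<cdot> h = q \<cdot> k\<rbrakk> \<Longrightarrow> h = k"
  shows "is_pullback C f g p q"
  unfolding is_pullback_def
proof (intro conjI allI ballI impI)
  fix X a b assume *: "a \<in> Hom C X (Src C f)" "b \<in> Hom C X (Src C g)" "f \<cdot> a = g \<cdot> b"
  then obtain h where h: "h \<in> Mor C" "Src C h = Src C a" "Tgt C h = Src C p" "p \<cdot> h = a" "q \<cdot> h = b"
    using ex[of a b] by (auto simp: Hom_def)
  show "\<exists>!h. h \<in> Hom C X (Src C p) \<and> p \<cdot> h = a \<and> q \<cdot> h = b"
  proof (rule ex1I[of _ h])
    show "h \<in> Hom C X (Src C p) \<and> p \<cdot> h = a \<and> q \<cdot> h = b" using h * by (auto simp: Hom_def)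
    show "k = h" if "k \<in> Hom C X (Src C p) \<and> p \<cdot> k = a \<and> q \<cdot> k = b" for k
      by (rule un) (use that h * in \<open>auto simp: Hom_def\<close>)
  qed
qed (use assms in auto)

lemma is_pullback_sym: "is_pullback C f g p q \<Longrightarrow> is_pullback C g f q p"
  unfolding is_pullback_def by metis

lemma pullback_Ident_left:
  assumes "f \<in> Mor C" "Tgt C f = A" "Src C f = B"
  shows "is_pullback C (Ident C A) f f (Ident C B)"
  using assms
  by (intro is_pullbackI) (auto intro: bexI)

lemma pullback_Ident_right:
  assumes "f \<in> Mor C" "Tgt C f = A" "Src C f = B"
  shows "is_pullback C f (Ident C A) (Ident C B) f"
  using pullback_Ident_left[OF assms] by (rule is_pullback_sym)

text \<open>A cone over the outer rectangle is lifted first through the square on \<open>f\<close>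
  and \<open>t\<close>, then through the square on \<open>q\<close> and \<open>r\<close>. Uniqueness
  uses joint monicity twice, in the same order.\<close>

lemma pullback_paste:
  assumes 1: "is_pullback C f t p q" and 2: "is_pullback C q r p' q'"
  shows "is_pullback C f (t \<cdot> r) (p \<cdot> p') q'"
proof -
  note P = is_pullbackD[OF 1] is_pullbackD[OF 2]
  show ?thesis
  proof (rule is_pullbackI)
    have "f \<cdot> (p \<cdot> p') = (f \<cdot> p) \<cdot> p'" using P by (intro Comp_assoc'[symmetric]) auto
    also have "\<dots> = t \<cdot> (q \<cdot> p')" unfolding pullback_comm[OF 1] using P by (intro Comp_assoc') auto
    also have "\<dots> = (t \<cdot> r) \<cdot> q'" unfolding pullback_comm[OF 2] using P by (intro Comp_assoc'[symmetric]) auto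
    finally show "f \<cdot> (p \<cdot> p') = (t \<cdot> r) \<cdot> q'" .
  next
    fix a b assume ab: "a \<in> Mor C" "b \<in> Mor C" "Src C b = Src C a" "Tgt C a = Src C f"
      "Tgt C b = Src C (t \<cdot> r)" "f \<cdot> a = (t \<cdot> r) \<cdot> b"
    have b: "Tgt C b = Src C r" using ab P by simp
    have "f \<cdot> a = t \<cdot> (r \<cdot> b)" using ab(1-4,6) b P by (simp add: Comp_assoc')
    then obtain h where h: "h \<in> Mor C" "Src C h = Src C a" "Tgt C h = Src C p" "p \<cdot> h = a" "q \<cdot> h = r \<cdot> b"
      using pullback_lift[OF 1, of a "r \<cdot> b"] ab b P by auto
    obtain k where k: "k \<in> Mor C" "Src C k = Src C h" "Tgt C k = Src C p'" "p' \<cdot> k = h" "q' \<cdot> k = b"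
      using pullback_lift[OF 2, of h b] ab b P h by auto
    have "(p \<cdot> p') \<cdot> k = a" using k h P by (simp add: Comp_assoc')
    then show "\<exists>h\<in>Mor C. Src C h = Src C a \<and> Tgt C h = Src C (p \<cdot> p') \<and> (p \<cdot> p') \<cdot> h = a \<and> q' \<cdot> h = b"
      using k h P by (intro bexI[of _ k]) auto
  next
    fix h k assume hk: "h \<in> Mor C" "k \<in> Mor C" "Src C k = Src C h" "Tgt C h = Src C (p \<cdot> p')"
      "Tgt C k = Src C (p \<cdot> p')" "(p \<cdot> p') \<cdot> h = (p \<cdot> p') \<cdot> k" "q' \<cdot> h = q' \<cdot> k"
    have s: "Tgt C h = Src C p'" "Tgt C k = Src C p'" using hk P by auto
    have p: "p \<cdot> (p' \<cdot> h) = p \<cdot> (p' \<cdot> k)"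
    proof -
      have "p \<cdot> (p' \<cdot> h) = (p \<cdot> p') \<cdot> h" using hk(1,2) s P by (intro Comp_assoc'[symmetric]) auto
      also have "\<dots> = p \<cdot> (p' \<cdot> k)" unfolding hk(6) using hk(1,2) s P by (intro Comp_assoc') auto
      finally show ?thesis .
    qed
    \<comment> \<open>Commutativity of the second square moves the equation for \<open>q'\<close> to
      \<open>q \<cdot> p'\<close>, as joint monicity of \<open>p\<close> and \<open>q\<close>
      requires.\<close>
    have q: "q \<cdot> (p' \<cdot> h) = q \<cdot> (p' \<cdot> k)"
    proof -
      have "q \<cdot> (p' \<cdot> h) = r \<cdot> (q' \<cdot> h)"
        using hk(1,2) s P pullback_comm[OF 2] by (simp flip: Comp_assoc')
      also have "\<dots> = q \<cdot> (p' \<cdot> k)"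
        unfolding hk(7) using hk(1,2) s P pullback_comm[OF 2] by (simp flip: Comp_assoc')
      finally show ?thesis .
    qed
    have "p' \<cdot> h = p' \<cdot> k"
      by (rule pullback_cancel[OF 1 _ _ _ _ _ p q]) (use hk(1-3) s P in simp_all)
    then show "h = k"
      by (rule pullback_cancel[OF 2 hk(1,2,3) s _ hk(7)])
  qed (use P in auto)
qed

text \<open>This converse of pasting exhibits the comparison \<open>y\<close> of two pullbacks as a
  pullback of \<open>r\<close>. If \<open>r\<close> is in \<open>S\<close>, then so is
  \<open>y\<close>.\<close>

lemma pullback_unpaste:
  assumes 1: "is_pullback C f (t \<cdot> r) P Q" and 2: "is_pullback C f t p q"
    and r: "r \<in> Mor C" "Tgt C r = Src C t"
  obtains y where "p \<cdot> y = P" "is_pullback C q r y Q"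
proof -
  note P = is_pullbackD[OF 1] is_pullbackD[OF 2]
  have sr: "Tgt C Q = Src C r" using P r by simp
  have "f \<cdot> P = t \<cdot> (r \<cdot> Q)" using P r sr pullback_comm[OF 1] by (simp add: Comp_assoc')
  then obtain y where y: "y \<in> Mor C" "Src C y = Src C P" "Tgt C y = Src C p" "p \<cdot> y = P" "q \<cdot> y = r \<cdot> Q"
    using pullback_lift[OF 2, of P "r \<cdot> Q"] P r sr by auto
  have "is_pullback C q r y Q"
  proof (rule is_pullbackI)
    fix a b assume ab: "a \<in> Mor C" "b \<in> Mor C" "Src C b = Src C a" "Tgt C a = Src C q"
      "Tgt C b = Src C r" "q \<cdot> a = r \<cdot> b"
    \<comment> \<open>A cone over the small square becomes one over the large square by composing
      \<open>a\<close> with \<open>p\<close>. The lift through the large square also serves the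
      small one, since \<open>p\<close> and \<open>q\<close> are jointly monic.\<close>
    have "f \<cdot> (p \<cdot> a) = (f \<cdot> p) \<cdot> a" using P ab by (intro Comp_assoc'[symmetric]) auto
    also have "\<dots> = t \<cdot> (q \<cdot> a)"
      unfolding pullback_comm[OF 2] using P ab by (intro Comp_assoc') auto
    also have "\<dots> = (t \<cdot> r) \<cdot> b" using P ab r by (simp add: Comp_assoc')
    finally obtain h where h: "h \<in> Mor C" "Src C h = Src C a" "Tgt C h = Src C P" "P \<cdot> h = p \<cdot> a" "Q \<cdot> h = b"
      using pullback_lift[OF 1, of "p \<cdot> a" b] P ab r by auto
    have "y \<cdot> h = a"
    proof (rule pullback_cancel[OF 2])
      show "p \<cdot> (y \<cdot> h) = p \<cdot> a" using h y P ab by (simp flip: Comp_assoc')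
      have "q \<cdot> (y \<cdot> h) = (q \<cdot> y) \<cdot> h" using h y P ab by (intro Comp_assoc'[symmetric]) auto
      also have "\<dots> = r \<cdot> (Q \<cdot> h)" using h y P ab r sr by (simp add: Comp_assoc')
      finally show "q \<cdot> (y \<cdot> h) = q \<cdot> a" using h ab by simp
    qed (use h y P ab in auto)
    then show "\<exists>h\<in>Mor C. Src C h = Src C a \<and> Tgt C h = Src C y \<and> y \<cdot> h = a \<and> Q \<cdot> h = b"
      using h y by (intro bexI[of _ h]) auto
  next
    fix h k assume hk: "h \<in> Mor C" "k \<in> Mor C" "Src C k = Src C h" "Tgt C h = Src C y"
      "Tgt C k = Src C y" "y \<cdot> h = y \<cdot> k" "Q \<cdot> h = Q \<cdot> k"
    have "(p \<cdot> y) \<cdot> h = p \<cdot> (y \<cdot> h)" using hk(1-5) y(1-3) P by (intro Comp_assoc') auto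
    also have "\<dots> = (p \<cdot> y) \<cdot> k"
      using hk(1-5) y(1-3) P unfolding hk(6) by (intro Comp_assoc'[symmetric]) auto
    finally have "P \<cdot> h = P \<cdot> k" unfolding y(4) .
    then show "h = k"
      using hk y(2) by (intro pullback_cancel[OF 1 hk(1,2,3)]) simp_all
  qed (use P y r sr in auto)
  then show thesis using that y by blast
qed

end

section \<open>Composition of spans\<close>

lemma least_equiv_incl: "r \<subseteq> least_equiv A r"
  by (auto simp: least_equiv_def)

lemma least_equiv_min: "\<lbrakk>equiv A R; r \<subseteq> R\<rbrakk> \<Longrightarrow> least_equiv A r \<subseteq> R"
  by (auto simp: least_equiv_def)

text \<open>The hypothesis makes \<open>A \<times> A\<close> a member of the intersected family;
  over an empty family the intersection would be the universal relation.\<close>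

lemma equiv_least_equiv:
  assumes "r \<subseteq> A \<times> A"
  shows "equiv A (least_equiv A r)"
proof (rule equivI)
  have "equiv A (A \<times> A)" by (auto simp: equiv_def refl_on_def sym_def trans_def)
  then show "least_equiv A r \<subseteq> A \<times> A" by (rule least_equiv_min) fact
  show "refl_on A (least_equiv A r)"
    by (auto simp: least_equiv_def refl_on_def equiv_def)
  show "sym (least_equiv A r)"
    by (auto simp: least_equiv_def equiv_def sym_def)
  show "trans (least_equiv A r)"
    unfolding least_equiv_def equiv_def trans_def by blast
qed

context span_setting
begin

lemma S_Mor [simp]: "s \<in> S \<Longrightarrow> s \<in> Mor C"
  using S_subset by auto

lemma Ident_S [simp]: "A \<in> Obj C \<Longrightarrow> Ident C A \<in> S"
  by (rule iso_in_S[OF Ident_iso])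

lemma Spans_iff [simp]: "(s, f) \<in> Spans C S \<longleftrightarrow> s \<in> S \<and> f \<in> Mor C \<and> Src C s = Src C f"
  by (simp add: Spans_def)

lemma parallel_spansD:
  assumes "(u, v) \<in> parallel_spans C S"
  shows "u \<in> Spans C S" "v \<in> Spans C S" "span_src C u = span_src C v" "span_tgt C u = span_tgt C v"
  using assms by (auto simp: parallel_spans_def)

lemma equiv_parallel: "equiv (Spans C S) (parallel_spans C S)"
  by (auto simp: equiv_def refl_on_def sym_def trans_def parallel_spans_def)

lemma hcompI:
  "\<lbrakk>is_pullback C f t t' f'; p = s \<cdot> t'; q = g \<cdot> f'\<rbrakk> \<Longrightarrow> (p, q) \<in> hcomp C (t, g) (s, f)"
  by auto

lemma hcomp_Spans:
  assumes "u \<in> Spans C S" "v \<in> Spans C S" "p \<in> hcomp C v u"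
  shows "p \<in> Spans C S" "span_src C p = span_src C u" "span_tgt C p = span_tgt C v"
    "span_tgt C u = span_src C v"
proof -
  obtain s f t g where [simp]: "u = (s, f)" "v = (t, g)" by (cases u, cases v)
  obtain t' f' where pb: "is_pullback C f t t' f'" and [simp]: "p = (s \<cdot> t', g \<cdot> f')"
    using assms by auto
  have "t' \<in> S" using pb assms by (auto intro: pullback_in_S)
  with is_pullbackD[OF pb] assms
  show "p \<in> Spans C S" "span_src C p = span_src C u" "span_tgt C p = span_tgt C v"
    "span_tgt C u = span_src C v"
    by (auto simp: span_src_def span_tgt_def intro: S_Comp)
qed

lemma parallel_hcomp:
  assumes uv: "(u, v) \<in> parallel_spans C S" and w: "w \<in> Spans C S"
  shows "\<lbrakk>p \<in> hcomp C w u; q \<in> hcomp C w v\<rbrakk> \<Longrightarrow> (p, q) \<in> parallel_spans C S"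
    and "\<lbrakk>p \<in> hcomp C u w; q \<in> hcomp C v w\<rbrakk> \<Longrightarrow> (p, q) \<in> parallel_spans C S"
proof -
  note uv = parallel_spansD[OF uv]
  show "(p, q) \<in> parallel_spans C S" if "p \<in> hcomp C w u" "q \<in> hcomp C w v"
    using hcomp_Spans[OF uv(1) w that(1)] hcomp_Spans[OF uv(2) w that(2)] uv(3)
    by (simp add: parallel_spans_def)
  show "(p, q) \<in> parallel_spans C S" if "p \<in> hcomp C u w" "q \<in> hcomp C v w"
    using hcomp_Spans[OF w uv(1) that(1)] hcomp_Spans[OF w uv(2) that(2)] uv(4)
    by (simp add: parallel_spans_def)
qed

lemma compatibleI:
  assumes "R \<subseteq> parallel_spans C S" "span_iso C S \<subseteq> R"
    and "\<And>u v w p q. \<lbrakk>(u, v) \<in> R; w \<in> Spans C S; p \<in> hcomp C w u; q \<in> hcomp C w v\<rbrakk> \<Longrightarrow> (p, q) \<in> R"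
    and "\<And>u v w p q. \<lbrakk>(u, v) \<in> R; w \<in> Spans C S; p \<in> hcomp C u w; q \<in> hcomp C v w\<rbrakk> \<Longrightarrow> (p, q) \<in> R"
  shows "compatible C S R"
  unfolding compatible_def using assms by blast

lemma hcomp_exists:
  assumes "u \<in> Spans C S" "v \<in> Spans C S" "span_tgt C u = span_src C v"
  obtains p where "p \<in> hcomp C v u"
proof -
  obtain s f t g where [simp]: "u = (s, f)" "v = (t, g)" by (cases u, cases v)
  obtain t' f' where "is_pullback C f t t' f'"
    using pullback_exists[of t f] assms by (auto simp: span_src_def span_tgt_def)
  then show thesis using that by auto
qed

section \<open>The order generating z and its stability under horizontal composition\<close>

lemma span_leI:
  assumes "(s, f) \<in> Spans C S" "x \<in> S" "Tgt C x = Src C s"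
  shows "((s \<cdot> x, f \<cdot> x), (s, f)) \<in> span_le C S"
proof -
  have "s \<cdot> x \<in> S" using assms by (intro S_Comp) simp_all
  then have "((s \<cdot> x, f \<cdot> x), (s, f)) \<in> parallel_spans C S"
    using assms by (simp add: parallel_spans_def span_src_def span_tgt_def)
  moreover have "vertical C x (s \<cdot> x, f \<cdot> x) (s, f)" using assms by (simp add: Hom_def)
  ultimately show ?thesis using assms(2) unfolding span_le_def by blast
qed

text \<open>The vertical morphism and the larger span determine the smaller one, so the order can be
  read as precomposition of both legs with some \<open>x\<close> in \<open>S\<close>.\<close>

lemma span_leE:
  assumes "(u, v) \<in> span_le C S"
  obtains s f x where "u = (s \<cdot> x, f \<cdot> x)" "v = (s, f)" "(s, f) \<in> Spans C S" "x \<in> S" "Tgt C x = Src C s"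
proof -
  obtain s' f' s f where uv: "u = (s', f')" "v = (s, f)" by (cases u, cases v)
  obtain x where "x \<in> S" and v: "v \<in> Spans C S" and "vertical C x u v"
    using assms unfolding span_le_def parallel_spans_def by blast
  then have x: "Tgt C x = Src C s" "s \<cdot> x = s'" "f \<cdot> x = f'"
    unfolding uv vertical.simps Hom_def by blast+
  show thesis by (rule that[of s x f, unfolded x(2,3), OF uv v[unfolded uv] \<open>x \<in> S\<close> x(1)])
qed

lemma span_le_hcomp_left:
  assumes "(u, v) \<in> span_le C S" and w: "w \<in> Spans C S" and "p \<in> hcomp C w u" and qv: "q \<in> hcomp C w v"
  shows "(p, q) \<in> span_le C S"
proof -
  obtain t g where w': "w = (t, g)" by (cases w)
  obtain s f x where u: "u = (s \<cdot> x, f \<cdot> x)" and v: "v = (s, f)"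
    and sf: "s \<in> S" "f \<in> Mor C" "Src C s = Src C f" and x: "x \<in> S" "Tgt C x = Src C s"
    using assms(1) by (auto elim: span_leE)
  obtain t1 f1 where 1: "is_pullback C (f \<cdot> x) t t1 f1" and p: "p = ((s \<cdot> x) \<cdot> t1, g \<cdot> f1)"
    using assms(3) by (auto simp: w' u)
  obtain t2 f2 where 2: "is_pullback C f t t2 f2" and q: "q = (s \<cdot> t2, g \<cdot> f2)"
    using qv by (auto simp: w' v)
  \<comment> \<open>Here the composite \<open>f \<cdot> x\<close> is the morphism along which
    \<open>t\<close> is pulled back. Reflecting both squares puts it in the place that
    \<open>pullback_unpaste\<close> expects, and \<open>y\<close> becomes the pullback of
    \<open>x\<close> along \<open>t2\<close>.\<close>
  obtain y where y: "f2 \<cdot> y = f1" and pb: "is_pullback C t2 x y t1"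
    using pullback_unpaste[OF is_pullback_sym[OF 1] is_pullback_sym[OF 2]] x sf by auto
  note P = is_pullbackD[OF 1] is_pullbackD[OF 2] is_pullbackD[OF pb]
  have "(s \<cdot> x) \<cdot> t1 = s \<cdot> (x \<cdot> t1)" using P x sf by (intro Comp_assoc') auto
  also have "\<dots> = (s \<cdot> t2) \<cdot> y"
    unfolding pullback_comm[OF pb, symmetric] using P sf by (intro Comp_assoc'[symmetric]) auto
  finally have "p = ((s \<cdot> t2) \<cdot> y, (g \<cdot> f2) \<cdot> y)"
    using P w by (simp add: p w' Comp_assoc' flip: y)
  moreover have "y \<in> S" using pullback_in_S[OF x(1) pb] .
  moreover have "q \<in> Spans C S" using hcomp_Spans(1)[OF _ w qv] sf by (simp add: v)
  ultimately show ?thesis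
    using span_leI[of "s \<cdot> t2" "g \<cdot> f2" y] P sf by (simp add: q)
qed

lemma span_le_hcomp_right:
  assumes "(u, v) \<in> span_le C S" and w: "w \<in> Spans C S" and "p \<in> hcomp C u w" and qv: "q \<in> hcomp C v w"
  shows "(p, q) \<in> span_le C S"
proof -
  obtain t g where w': "w = (t, g)" by (cases w)
  obtain s f x where u: "u = (s \<cdot> x, f \<cdot> x)" and v: "v = (s, f)"
    and sf: "s \<in> S" "f \<in> Mor C" "Src C s = Src C f" and x: "x \<in> S" "Tgt C x = Src C s"
    using assms(1) by (auto elim: span_leE)
  obtain s1 g1 where 1: "is_pullback C g (s \<cdot> x) s1 g1" and p: "p = (t \<cdot> s1, (f \<cdot> x) \<cdot> g1)"
    using assms(3) by (auto simp: w' u)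
  obtain s2 g2 where 2: "is_pullback C g s s2 g2" and q: "q = (t \<cdot> s2, f \<cdot> g2)"
    using qv by (auto simp: w' v)
  obtain y where y: "s2 \<cdot> y = s1" and pb: "is_pullback C g2 x y g1"
    using pullback_unpaste[OF 1 2] x sf by auto
  note P = is_pullbackD[OF 1] is_pullbackD[OF 2] is_pullbackD[OF pb]
  have "(f \<cdot> x) \<cdot> g1 = f \<cdot> (x \<cdot> g1)" using P x sf by (intro Comp_assoc') auto
  also have "\<dots> = (f \<cdot> g2) \<cdot> y"
    unfolding pullback_comm[OF pb, symmetric] using P sf by (intro Comp_assoc'[symmetric]) auto
  finally have "p = ((t \<cdot> s2) \<cdot> y, (f \<cdot> g2) \<cdot> y)"
    using P w by (simp add: p w' Comp_assoc' flip: y)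
  moreover have "y \<in> S" using pullback_in_S[OF x(1) pb] .
  moreover have "q \<in> Spans C S" using hcomp_Spans(1)[OF w _ qv] sf by (simp add: v)
  ultimately show ?thesis
    using span_leI[of "t \<cdot> s2" "f \<cdot> g2" y] P w by (simp add: q w')
qed

lemma span_le_refl: "u \<in> Spans C S \<Longrightarrow> (u, u) \<in> span_le C S"
  by (cases u) (auto simp: span_le_def parallel_spans_def Hom_def
      intro!: bexI[of _ "Ident C (Src C (fst u))"])

lemma span_iso_le: "span_iso C S \<subseteq> span_le C S"
  by (auto simp: span_iso_def span_le_def intro: iso_in_S)

section \<open>Quotients by compatible equivalence relations\<close>

context
  fixes R
  assumes equivR: "equiv (Spans C S) R" and compR: "compatible C S R"
begin

lemma R_parallel: "(u, v) \<in> R \<Longrightarrow> (u, v) \<in> parallel_spans C S"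
  using compR by (auto simp: compatible_def)

text \<open>Compatibility varies one factor at a time, so \<open>p\<close> and \<open>q\<close> are
  linked through a composite \<open>m\<close> of \<open>u'\<close> and \<open>v\<close>. Such an
  \<open>m\<close> exists because related spans have the same endpoints.\<close>

lemma R_hcomp:
  assumes u: "(u, u') \<in> R" and v: "(v, v') \<in> R" and p: "p \<in> hcomp C v u" and q: "q \<in> hcomp C v' u'"
  shows "(p, q) \<in> R"
proof -
  note U = parallel_spansD[OF R_parallel[OF u]] and V = parallel_spansD[OF R_parallel[OF v]]
  have "span_tgt C u' = span_src C v"
    using hcomp_Spans(4)[OF U(1) V(1) p] U by simp
  then obtain m where m: "m \<in> hcomp C v u'" using hcomp_exists U V by metis
  have "(p, m) \<in> R" using compR u V(1) p m unfolding compatible_def by blast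
  moreover have "(m, q) \<in> R" using compR v U(2) m q unfolding compatible_def by blast
  ultimately show ?thesis using equivR by (auto simp: equiv_def elim: transE)
qed

lemma R_refl: "u \<in> Spans C S \<Longrightarrow> (u, u) \<in> R"
  using equivR by (auto simp: equiv_def refl_on_def)

text \<open>\<open>R\<close> relates only parallel spans, so all members of a class give the same
  object and the description by \<open>THE\<close> is determined.\<close>

lemma Src_class: "u \<in> Spans C S \<Longrightarrow> Src (Span_quot C S R) (R `` {u}) = span_src C u"
  and Tgt_class: "u \<in> Spans C S \<Longrightarrow> Tgt (Span_quot C S R) (R `` {u}) = span_tgt C u"
proof -
  have eq: "(THE A. \<exists>v \<in> R `` {u}. A = h v) = h u"
    if "u \<in> Spans C S" "\<And>v. (u, v) \<in> R \<Longrightarrow> h u = h v" for h :: "'m \<times> 'm \<Rightarrow> 'o"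
    using R_refl[OF that(1)] that(2) by (intro the_equality) (blast, metis Image_singleton_iff)
  show "u \<in> Spans C S \<Longrightarrow> Src (Span_quot C S R) (R `` {u}) = span_src C u"
    unfolding Span_quot_def cat.simps by (rule eq) (use R_parallel parallel_spansD in blast)+
  show "u \<in> Spans C S \<Longrightarrow> Tgt (Span_quot C S R) (R `` {u}) = span_tgt C u"
    unfolding Span_quot_def cat.simps by (rule eq) (use R_parallel parallel_spansD in blast)+
qed

text \<open>By \<open>R_hcomp\<close>, other representatives or another pullback move the composite
  only within its class. The union that defines \<open>Comp\<close> therefore collapses to the class
  of \<open>p\<close>.\<close>

lemma Comp_class:
  assumes "u \<in> Spans C S" "v \<in> Spans C S" "p \<in> hcomp C v u"
  shows "Comp (Span_quot C S R) (R `` {v}) (R `` {u}) = R `` {p}"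
proof -
  have "(p, r) \<in> R"
    if "(u, u') \<in> R" "(v, v') \<in> R" "q \<in> hcomp C v' u'" "(q, r) \<in> R" for u' v' q r
    using R_hcomp[OF that(1,2) assms(3) that(3)] that(4) equivR by (auto simp: equiv_def elim: transE)
  moreover have "(u, u) \<in> R" "(v, v) \<in> R" using assms R_refl by auto
  ultimately show ?thesis
    using assms(3) by (auto simp: Span_quot_def Image_def)
qed

lemma Mor_class: "X \<in> Mor (Span_quot C S R) \<longleftrightarrow> (\<exists>u \<in> Spans C S. X = R `` {u})"
  by (auto simp: Span_quot_def elim: quotientE intro: quotientI)

lemma hcomp_Ident:
  assumes "(s, f) \<in> Spans C S"
  shows "(s, f) \<in> hcomp C (Ident C (Tgt C f), Ident C (Tgt C f)) (s, f)"
    and "(s, f) \<in> hcomp C (s, f) (Ident C (Tgt C s), Ident C (Tgt C s))"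
proof -
  show "(s, f) \<in> hcomp C (Ident C (Tgt C f), Ident C (Tgt C f)) (s, f)"
    using assms by (intro hcompI[OF pullback_Ident_right]) auto
  show "(s, f) \<in> hcomp C (s, f) (Ident C (Tgt C s), Ident C (Tgt C s))"
    using assms by (intro hcompI[OF pullback_Ident_left]) auto
qed

text \<open>Composites are sets, so associativity only needs one span that both bracketings share.
  It comes from one further pullback, of \<open>r'\<close> along \<open>f'\<close>, pasted once to
  the square for \<open>v\<close>, \<open>u\<close> and once to the square for \<open>w\<close>,
  \<open>v\<close>.\<close>

lemma hcomp_assoc:
  assumes "u \<in> Spans C S" "v \<in> Spans C S" "w \<in> Spans C S"
    and "vu \<in> hcomp C v u" "wv \<in> hcomp C w v"
  obtains p where "p \<in> hcomp C w vu" "p \<in> hcomp C wv u"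
proof -
  obtain s f t g r h where [simp]: "u = (s, f)" "v = (t, g)" "w = (r, h)"
    by (cases u, cases v, cases w)
  obtain t' f' where 1: "is_pullback C f t t' f'" and vu: "vu = (s \<cdot> t', g \<cdot> f')"
    using assms by auto
  obtain r' g' where 2: "is_pullback C g r r' g'" and wv: "wv = (t \<cdot> r', h \<cdot> g')"
    using assms by auto
  note P = is_pullbackD[OF 1] is_pullbackD[OF 2]
  have "r' \<in> S" using 2 assms by (auto intro: pullback_in_S)
  then obtain r1 f1 where 3: "is_pullback C f' r' r1 f1"
    using pullback_exists[of r' f'] P assms by auto
  note P = P is_pullbackD[OF 3]
  have "is_pullback C f (t \<cdot> r') (t' \<cdot> r1) f1" by (rule pullback_paste[OF 1 3])
  then have wv_u: "(s \<cdot> (t' \<cdot> r1), (h \<cdot> g') \<cdot> f1) \<in> hcomp C wv u"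
    by (auto simp: wv)
  have "is_pullback C (g \<cdot> f') r r1 (g' \<cdot> f1)"
    using pullback_paste[OF is_pullback_sym[OF 2] is_pullback_sym[OF 3]] by (rule is_pullback_sym)
  moreover have "s \<cdot> (t' \<cdot> r1) = (s \<cdot> t') \<cdot> r1" "(h \<cdot> g') \<cdot> f1 = h \<cdot> (g' \<cdot> f1)"
    using P assms by (auto intro!: Comp_assoc' Comp_assoc'[symmetric])
  ultimately have "(s \<cdot> (t' \<cdot> r1), (h \<cdot> g') \<cdot> f1) \<in> hcomp C w vu"
    unfolding vu \<open>w = (r, h)\<close> by (rule hcompI)
  then show thesis using wv_u by (rule that)
qed

lemma category_Span_quot: "category (Span_quot C S R)" (is "category ?Q")
proof
  note classes = Src_class Tgt_class
  have [simp]: "Obj ?Q = Obj C"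
    and Id: "Ident ?Q A = R `` {(Ident C A, Ident C A)}" for A
    by (auto simp: Span_quot_def)
  have span_Obj: "span_src C u \<in> Obj C" "span_tgt C u \<in> Obj C" if "u \<in> Spans C S" for u
    using that by (cases u; auto simp: span_src_def span_tgt_def)+
  show "Src ?Q X \<in> Obj ?Q" "Tgt ?Q X \<in> Obj ?Q" if "X \<in> Mor ?Q" for X
    using that by (auto simp: Mor_class classes span_Obj)
  have Hom: "X \<in> Hom ?Q A B \<longleftrightarrow> (\<exists>u \<in> Spans C S. X = R `` {u} \<and> span_src C u = A \<and> span_tgt C u = B)" for X A B
    by (auto simp: Hom_def Mor_class classes)
  show "Ident ?Q A \<in> Hom ?Q A A" if "A \<in> Obj ?Q" for A
    using that by (auto simp: Id Hom span_src_def span_tgt_def intro!: bexI[of _ "(Ident C A, Ident C A)"])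
  show "Comp ?Q Y X \<in> Hom ?Q A D" if XY: "X \<in> Hom ?Q A B" "Y \<in> Hom ?Q B D" for X Y A B D
  proof -
    obtain u v where u: "u \<in> Spans C S" "X = R `` {u}" "span_src C u = A" "span_tgt C u = B"
      and v: "v \<in> Spans C S" "Y = R `` {v}" "span_src C v = B" "span_tgt C v = D"
      using XY by (auto simp: Hom)
    obtain p where p: "p \<in> hcomp C v u" using hcomp_exists u v by metis
    show ?thesis
      using hcomp_Spans[OF u(1) v(1) p] u v by (auto simp: Comp_class[OF u(1) v(1) p] Hom)
  qed
  show "Comp ?Q X (Ident ?Q (Src ?Q X)) = X" "Comp ?Q (Ident ?Q (Tgt ?Q X)) X = X"
    if X: "X \<in> Mor ?Q" for X
  proof -
    obtain s f where sf: "(s, f) \<in> Spans C S" and XX: "X = R `` {(s, f)}"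
      using X by (auto simp: Mor_class)
    show "Comp ?Q X (Ident ?Q (Src ?Q X)) = X"
      unfolding Id XX Src_class[OF sf]
      by (rule Comp_class) (use sf hcomp_Ident in \<open>auto simp: span_src_def simp del: hcomp.simps\<close>)
    show "Comp ?Q (Ident ?Q (Tgt ?Q X)) X = X"
      unfolding Id XX Tgt_class[OF sf]
      by (rule Comp_class) (use sf hcomp_Ident in \<open>auto simp: span_tgt_def simp del: hcomp.simps\<close>)
  qed
  show "Comp ?Q (Comp ?Q Z Y) X = Comp ?Q Z (Comp ?Q Y X)"
    if XYZ: "X \<in> Hom ?Q A B" "Y \<in> Hom ?Q B D" "Z \<in> Hom ?Q D E" for X Y Z A B D E
  proof -
    obtain u v w where u: "u \<in> Spans C S" "X = R `` {u}" "span_src C u = A" "span_tgt C u = B"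
      and v: "v \<in> Spans C S" "Y = R `` {v}" "span_src C v = B" "span_tgt C v = D"
      and w: "w \<in> Spans C S" "Z = R `` {w}" "span_src C w = D" "span_tgt C w = E"
      using XYZ by (auto simp: Hom)
    obtain vu wv where vu: "vu \<in> hcomp C v u" and wv: "wv \<in> hcomp C w v"
      using hcomp_exists u v w by metis
    obtain p where p: "p \<in> hcomp C w vu" "p \<in> hcomp C wv u"
      using hcomp_assoc[OF u(1) v(1) w(1) vu wv] .
    have "vu \<in> Spans C S" "wv \<in> Spans C S"
      using hcomp_Spans vu wv u v w by blast+
    then show ?thesis
      using u v w vu wv p by (simp add: Comp_class)
  qed
qed

lemma is_functor_Span_quot: "is_functor C (Span_quot C S R) (Span_quot_functor C R)"
  unfolding is_functor_def
proof (intro conjI ballI impI)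
  have [simp]: "on_mor (Span_quot_functor C R) f = R `` {(Ident C (Src C f), f)}"
    "on_obj (Span_quot_functor C R) A = A" for f A
    by (simp_all add: Span_quot_functor_def)
  show "on_obj (Span_quot_functor C R) A \<in> Obj (Span_quot C S R)" if "A \<in> Obj C" for A
    using that by (simp add: Span_quot_def)
  show "on_mor (Span_quot_functor C R) f
      \<in> Hom (Span_quot C S R) (on_obj (Span_quot_functor C R) (Src C f)) (on_obj (Span_quot_functor C R) (Tgt C f))"
    if "f \<in> Mor C" for f
    using that by (auto simp: Hom_def Mor_class Src_class Tgt_class span_src_def span_tgt_def)
  show "on_mor (Span_quot_functor C R) (Ident C A)
      = Ident (Span_quot C S R) (on_obj (Span_quot_functor C R) A)" if "A \<in> Obj C" for A
    using that by (simp add: Span_quot_def)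
  show "on_mor (Span_quot_functor C R) (g \<cdot> f)
      = Comp (Span_quot C S R) (on_mor (Span_quot_functor C R) g) (on_mor (Span_quot_functor C R) f)"
    if "f \<in> Mor C" "g \<in> Mor C" "Src C g = Tgt C f" for f g
  proof -
    \<comment> \<open>The identity is pulled back along \<open>f\<close> to an identity, with
      \<open>f\<close> as the other leg.\<close>
    have "(Ident C (Src C f), g \<cdot> f) \<in> hcomp C (Ident C (Src C g), g) (Ident C (Src C f), f)"
      using that by (intro hcompI[OF pullback_Ident_right]) auto
    then show ?thesis using that by (simp add: Comp_class del: hcomp.simps)
  qed
qed

end

section \<open>The relation az\<close>

lemma cospan_leE:
  assumes "(c, d) \<in> cospan_le C S"
  obtains f s v where "c = (f, s)" "d = (v \<cdot> f, v \<cdot> s)" "f \<in> Mor C" "s \<in> S" "Tgt C f = Tgt C s"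
    "v \<in> S" "Src C v = Tgt C f"
proof -
  obtain f s g t where cd: "c = (f, s)" "d = (g, t)" by (cases c, cases d)
  then have "f \<in> Mor C" "s \<in> S" "Tgt C f = Tgt C s"
    using assms unfolding cospan_le_def Cospans_def by blast+
  moreover obtain v where "v \<in> S" "Src C v = Tgt C f" "g = v \<cdot> f" "t = v \<cdot> s"
    using assms unfolding cd cospan_le_def by blast
  ultimately show thesis using that[of f s v] cd by blast
qed

lemma pb_Spans:
  assumes "(f, s) \<in> Cospans C S" "p \<in> pb C (f, s)"
  shows "p \<in> Spans C S" "span_src C p = Src C f" "span_tgt C p = Src C s"
proof -
  obtain s' f' where p: "p = (s', f')" and pb: "is_pullback C f s s' f'"
    using assms(2) by auto
  then have "s' \<in> S" using assms(1) pullback_in_S unfolding Cospans_def by blast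
  then show "p \<in> Spans C S" "span_src C p = Src C f" "span_tgt C p = Src C s"
    using is_pullbackD[OF pb] by (simp_all add: p span_src_def span_tgt_def)
qed

lemma pb_parallel:
  assumes "(c, d) \<in> cospan_le C S" "p \<in> pb C c" "q \<in> pb C d"
  shows "(p, q) \<in> parallel_spans C S"
proof -
  obtain f s v where c: "c = (f, s)" and d: "d = (v \<cdot> f, v \<cdot> s)"
    and fs: "f \<in> Mor C" "s \<in> S" "Tgt C f = Tgt C s" "v \<in> S" "Src C v = Tgt C f"
    using cospan_leE[OF assms(1)] by blast
  have "v \<cdot> s \<in> S" using fs by (intro S_Comp) simp_all
  then have "(f, s) \<in> Cospans C S" "(v \<cdot> f, v \<cdot> s) \<in> Cospans C S"
    using fs by (simp_all add: Cospans_def)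
  note 1 = pb_Spans[OF this(1) assms(2)[unfolded c]] and 2 = pb_Spans[OF this(2) assms(3)[unfolded d]]
  show ?thesis unfolding parallel_spans_def using 1 2 fs by simp
qed

text \<open>This is the largest compatible relation. By \<open>pb_parallel\<close> it belongs to the
  family whose intersection is \<open>approx_a\<close>, and so bounds it.\<close>

lemma compatible_parallel: "compatible C S (parallel_spans C S)"
proof (rule compatibleI)
  show "span_iso C S \<subseteq> parallel_spans C S" unfolding span_iso_def by blast
qed (blast intro: parallel_hcomp)+

lemma approx_a_parallel: "approx_a C S \<subseteq> parallel_spans C S"
  unfolding approx_a_def using compatible_parallel pb_parallel by blast

lemma approx_a_min:
  assumes "compatible C S R" "\<And>c d. (c, d) \<in> cospan_le C S \<Longrightarrow> pb C c \<times> pb C d \<subseteq> R"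
  shows "approx_a C S \<subseteq> R"
  using assms unfolding approx_a_def by blast

lemma approx_a_hcomp:
  assumes "(u, v) \<in> approx_a C S" "w \<in> Spans C S"
  shows "\<lbrakk>p \<in> hcomp C w u; q \<in> hcomp C w v\<rbrakk> \<Longrightarrow> (p, q) \<in> approx_a C S"
    and "\<lbrakk>p \<in> hcomp C u w; q \<in> hcomp C v w\<rbrakk> \<Longrightarrow> (p, q) \<in> approx_a C S"
  using assms unfolding approx_a_def compatible_def by blast+

lemma approx_a_pb: "(c, d) \<in> cospan_le C S \<Longrightarrow> pb C c \<times> pb C d \<subseteq> approx_a C S"
  unfolding approx_a_def by blast

text \<open>The nested closures collapse: an equivalence relation that contains the generators of z
  and a contains both closures, hence also their join.\<close>

lemma sim_az_min:
  assumes "equiv (Spans C S) R" "span_le C S \<subseteq> R" "approx_a C S \<subseteq> R"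
  shows "sim_az C S \<subseteq> R"
  unfolding sim_az_def sim_z_def sim_a_def
  by (intro least_equiv_min Un_least assms)

lemma span_le_az: "span_le C S \<subseteq> sim_az C S"
proof -
  have "span_le C S \<subseteq> sim_z C S" unfolding sim_z_def by (rule least_equiv_incl)
  also have "\<dots> \<subseteq> sim_z C S \<union> sim_a C S" by (rule Un_upper1)
  also have "\<dots> \<subseteq> sim_az C S" unfolding sim_az_def by (rule least_equiv_incl)
  finally show ?thesis .
qed

lemma approx_a_az: "approx_a C S \<subseteq> sim_az C S"
proof -
  have "approx_a C S \<subseteq> sim_a C S" unfolding sim_a_def by (rule least_equiv_incl)
  also have "\<dots> \<subseteq> sim_z C S \<union> sim_a C S" by (rule Un_upper2)
  also have "\<dots> \<subseteq> sim_az C S" unfolding sim_az_def by (rule least_equiv_incl)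
  finally show ?thesis .
qed

lemma span_le_parallel: "span_le C S \<subseteq> parallel_spans C S"
  unfolding span_le_def by blast

lemma equiv_az: "equiv (Spans C S) (sim_az C S)"
  unfolding sim_az_def
proof (rule equiv_least_equiv)
  have "sim_z C S \<union> sim_a C S \<subseteq> parallel_spans C S"
    unfolding sim_z_def sim_a_def
    by (intro Un_least least_equiv_min equiv_parallel span_le_parallel approx_a_parallel)
  then show "sim_z C S \<union> sim_a C S \<subseteq> Spans C S \<times> Spans C S"
    using equiv_type[OF equiv_parallel] by blast
qed

lemma az_parallel: "sim_az C S \<subseteq> parallel_spans C S"
  by (intro sim_az_min equiv_parallel span_le_parallel approx_a_parallel)

lemma az_trans: "\<lbrakk>(u, v) \<in> sim_az C S; (v, w) \<in> sim_az C S\<rbrakk> \<Longrightarrow> (u, w) \<in> sim_az C S"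
  using equiv_az unfolding equiv_def trans_def by blast

lemma az_sym: "(u, v) \<in> sim_az C S \<Longrightarrow> (v, u) \<in> sim_az C S"
  using equiv_az unfolding equiv_def sym_def by blast

text \<open>Let \<open>R\<close> consist of the az-related pairs whose composites with any span, on
  either side, are az-related again. It is an equivalence relation containing the generators, so
  minimality makes it all of az.\<close>

lemma compatible_az: "compatible C S (sim_az C S)"
proof -
  define R where "R = {(u, v) \<in> sim_az C S. \<forall>w \<in> Spans C S.
        (\<forall>p \<in> hcomp C w u. \<forall>q \<in> hcomp C w v. (p, q) \<in> sim_az C S) \<and>
        (\<forall>p \<in> hcomp C u w. \<forall>q \<in> hcomp C v w. (p, q) \<in> sim_az C S)}"
  have RI: "(u, v) \<in> R" if "(u, v) \<in> sim_az C S"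
    "\<And>w p q. \<lbrakk>w \<in> Spans C S; p \<in> hcomp C w u; q \<in> hcomp C w v\<rbrakk> \<Longrightarrow> (p, q) \<in> sim_az C S"
    "\<And>w p q. \<lbrakk>w \<in> Spans C S; p \<in> hcomp C u w; q \<in> hcomp C v w\<rbrakk> \<Longrightarrow> (p, q) \<in> sim_az C S" for u v
    unfolding R_def using that by simp
  have R_az: "(u, v) \<in> sim_az C S" if "(u, v) \<in> R" for u v
    using that unfolding R_def by simp
  have R_left: "(p, q) \<in> sim_az C S"
    if "(u, v) \<in> R" "w \<in> Spans C S" "p \<in> hcomp C w u" "q \<in> hcomp C w v" for u v w p q
    using that unfolding R_def by simp
  have R_right: "(p, q) \<in> sim_az C S"
    if "(u, v) \<in> R" "w \<in> Spans C S" "p \<in> hcomp C u w" "q \<in> hcomp C v w" for u v w p q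
    using that unfolding R_def by simp
  have le: "span_le C S \<subseteq> R"
    by (intro subrelI RI) (blast intro: span_le_hcomp_left span_le_hcomp_right span_le_az[THEN subsetD])+
  have "equiv (Spans C S) R"
  proof (rule equivI)
    have "R \<subseteq> sim_az C S" by (intro subrelI R_az)
    also note equiv_type[OF equiv_az]
    finally show "R \<subseteq> Spans C S \<times> Spans C S" .
    \<comment> \<open>Reflexivity has content here: composites of the same spans formed with
      different pullbacks must be az-related. Reflexivity of \<open>span_le\<close> together with
      its inclusion in \<open>R\<close> provides this.\<close>
    show "refl_on (Spans C S) R"
      using le span_le_refl unfolding refl_on_def by blast
    show "sym R"
      by (intro symI RI) (blast intro: az_sym R_az R_left R_right)+
    show "trans R"
    proof (rule transI)
      fix u v w assume uv: "(u, v) \<in> R" and vw: "(v, w) \<in> R"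
      have "(u, v) \<in> parallel_spans C S" using az_parallel R_az[OF uv] by blast
      note U = parallel_spansD[OF this]
      show "(u, w) \<in> R"
      proof (rule RI)
        show "(u, w) \<in> sim_az C S" using R_az[OF uv] R_az[OF vw] by (rule az_trans)
      next
        fix x p q assume x: "x \<in> Spans C S" and p: "p \<in> hcomp C x u" and q: "q \<in> hcomp C x w"
        \<comment> \<open>Transitivity needs an intermediate composite with \<open>v\<close>; it
          exists because \<open>u\<close> and \<open>v\<close> are parallel and \<open>u\<close> can
          be composed with \<open>x\<close>.\<close>
        have "span_tgt C v = span_src C x" using hcomp_Spans(4)[OF U(1) x p] U(4) by simp
        then obtain m where m: "m \<in> hcomp C x v" using hcomp_exists[OF U(2) x] by blast
        show "(p, q) \<in> sim_az C S" using R_left[OF uv x p m] R_left[OF vw x m q] by (rule az_trans)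
      next
        fix x p q assume x: "x \<in> Spans C S" and p: "p \<in> hcomp C u x" and q: "q \<in> hcomp C w x"
        have "span_tgt C x = span_src C v" using hcomp_Spans(4)[OF x U(1) p] U(3) by simp
        then obtain m where m: "m \<in> hcomp C v x" using hcomp_exists[OF x U(2)] by blast
        show "(p, q) \<in> sim_az C S" using R_right[OF uv x p m] R_right[OF vw x m q] by (rule az_trans)
      qed
    qed
  qed
  moreover have "approx_a C S \<subseteq> R"
    by (intro subrelI RI) (blast intro: approx_a_hcomp approx_a_az[THEN subsetD])+
  ultimately have "sim_az C S \<subseteq> R" using le by (intro sim_az_min)
  moreover have "span_iso C S \<subseteq> sim_az C S" using span_iso_le span_le_az by blast
  ultimately show ?thesis using az_parallel R_left R_right by (intro compatibleI) blast+
qed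

section \<open>The quotient by az and the inverses of the morphisms in S\<close>

lemmas category_Span_az = category_Span_quot[OF equiv_az compatible_az, folded Span_az_def]
lemmas is_functor_Phi_az =
  is_functor_Span_quot[OF equiv_az compatible_az, folded Span_az_def Phi_az_def]
lemmas Comp_class_az = Comp_class[OF equiv_az compatible_az, folded Span_az_def]
lemmas Src_class_az = Src_class[OF equiv_az compatible_az, folded Span_az_def]
lemmas Tgt_class_az = Tgt_class[OF equiv_az compatible_az, folded Span_az_def]
lemmas Mor_class_az = Mor_class[OF equiv_az compatible_az, folded Span_az_def]

abbreviation az_class :: "'m \<times> 'm \<Rightarrow> ('m \<times> 'm) set" where
  "az_class u \<equiv> sim_az C S `` {u}"

lemma Obj_az [simp]: "Obj (Span_az C S) = Obj C"
  and Ident_az: "Ident (Span_az C S) A = az_class (Ident C A, Ident C A)"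
  and Phi_az_mor: "on_mor (Phi_az C S) f = az_class (Ident C (Src C f), f)"
  and Phi_az_obj: "on_obj (Phi_az C S) A = A"
  by (simp_all add: Span_az_def Span_quot_def Phi_az_def Span_quot_functor_def)

lemma az_class_eqI: "(u, v) \<in> sim_az C S \<Longrightarrow> az_class u = az_class v"
  using equiv_class_eq[OF equiv_az] .

lemma az_class_inverse:
  assumes s: "s \<in> S"
  defines "i \<equiv> Ident C (Src C s)"
  shows "Comp (Span_az C S) (az_class (i, s)) (az_class (s, i)) = Ident (Span_az C S) (Tgt C s)"
    and "Comp (Span_az C S) (az_class (s, i)) (az_class (i, s)) = Ident (Span_az C S) (Src C s)"
proof -
  define j where "j = Ident C (Tgt C s)"
  have i: "i \<in> Mor C" "i \<in> S" "Src C i = Src C s" "Tgt C i = Src C s"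
    and j: "j \<in> Mor C" "j \<in> S" "Src C j = Tgt C s" "Tgt C j = Tgt C s"
    and id: "s \<cdot> i = s" "i \<cdot> i = i" "j \<cdot> s = s"
    using s by (simp_all add: i_def j_def)
  have is_Spans: "(i, s) \<in> Spans C S" "(s, i) \<in> Spans C S" using s i by simp_all
  have pb: "is_pullback C i i i i"
    using pullback_Ident_left[OF i(1,4,3)] by (simp add: i_def)
  have "(s, s) \<in> hcomp C (i, s) (s, i)"
    by (rule hcompI[OF pb]) (simp_all only: id)
  note comp = Comp_class_az[OF is_Spans(2,1) this]
  \<comment> \<open>Written in this form, \<open>(s, s)\<close> lies below the identity span with
    \<open>s\<close> itself as the vertical morphism.\<close>
  have "((j \<cdot> s, j \<cdot> s), (j, j)) \<in> span_le C S"
    by (rule span_leI) (simp_all add: s j)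
  then have "((s, s), (j, j)) \<in> sim_az C S"
    using span_le_az unfolding id by blast
  then show "Comp (Span_az C S) (az_class (i, s)) (az_class (s, i)) = Ident (Span_az C S) (Tgt C s)"
    unfolding comp Ident_az j_def by (rule az_class_eqI)
  obtain p q where pq: "is_pullback C s s p q" using pullback_exists[OF s S_Mor[OF s]] by auto
  note P = is_pullbackD[OF pq]
  have "(p, q) \<in> hcomp C (s, i) (i, s)"
    by (rule hcompI[OF pq]) (use P in \<open>simp_all add: i_def\<close>)
  note comp = Comp_class_az[OF is_Spans this]
  have "(i, i) \<in> Cospans C S" "(s, s) \<in> Cospans C S"
    using s i by (simp_all add: Cospans_def)
  \<comment> \<open>The comparison of cospans is again \<open>s\<close>; their pullbacks are the
    identity span and the kernel pair \<open>(p, q)\<close>.\<close>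
  then have "((i, i), (s, s)) \<in> cospan_le C S"
    unfolding cospan_le_def mem_Collect_eq prod.case
    by (intro conjI bexI[OF _ s]) (simp_all only: i id)
  moreover have "(i, i) \<in> pb C (i, i)" "(p, q) \<in> pb C (s, s)" using pb pq by simp_all
  ultimately have "((i, i), (p, q)) \<in> approx_a C S"
    using approx_a_pb by blast
  then have "((p, q), (i, i)) \<in> sim_az C S"
    using approx_a_az by (blast intro: az_sym)
  then show "Comp (Span_az C S) (az_class (s, i)) (az_class (i, s)) = Ident (Span_az C S) (Src C s)"
    unfolding comp Ident_az i_def[symmetric] by (rule az_class_eqI)
qed

lemma inverts_Phi_az: "inverts S (Span_az C S) (Phi_az C S)"
  unfolding inverts_def Phi_az_mor
proof
  interpret Q: category "Span_az C S" by (rule category_Span_az)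
  fix s assume s: "s \<in> S"
  show "is_iso (Span_az C S) (az_class (Ident C (Src C s), s))"
    by (rule Q.is_isoI[where g = "az_class (s, Ident C (Src C s))"])
      (use s in \<open>auto simp: Mor_class_az Src_class_az Tgt_class_az az_class_inverse span_src_def span_tgt_def\<close>)
qed

end

section \<open>The universal property\<close>

locale inverting_functor = span_setting C S + D: category D
  for C :: "('o, 'm) cat" (structure) and S and D :: "('p, 'q) cat" and F :: "('o, 'm, 'p, 'q) func" +
  assumes F_functor: "is_functor C D F" and inverting: "inverts S D F"
begin

section \<open>Images of the morphisms in S and their inverses\<close>

lemma F_Obj [simp]: "A \<in> Obj C \<Longrightarrow> on_obj F A \<in> Obj D"
  and F_Ident [simp]: "A \<in> Obj C \<Longrightarrow> on_mor F (Ident C A) = Ident D (on_obj F A)"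
  and F_Mor [simp]: "f \<in> Mor C \<Longrightarrow> on_mor F f \<in> Mor D"
  and F_Src [simp]: "f \<in> Mor C \<Longrightarrow> Src D (on_mor F f) = on_obj F (Src C f)"
  and F_Tgt [simp]: "f \<in> Mor C \<Longrightarrow> Tgt D (on_mor F f) = on_obj F (Tgt C f)"
  and F_Comp: "\<lbrakk>f \<in> Mor C; g \<in> Mor C; Src C g = Tgt C f\<rbrakk>
    \<Longrightarrow> on_mor F (g \<cdot> f) = on_mor F g \<cdot>\<^bsub>D\<^esub> on_mor F f"
  using F_functor by (auto simp: is_functor_def Hom_def)

lemma F_iso: "s \<in> S \<Longrightarrow> is_iso D (on_mor F s)"
  using inverting by (simp add: inverts_def)

abbreviation Finv :: "'m \<Rightarrow> 'q" where
  "Finv s \<equiv> D.inv_mor (on_mor F s)"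

lemma Finv [simp]:
  assumes "s \<in> S"
  shows "Finv s \<in> Mor D" "Src D (Finv s) = on_obj F (Tgt C s)" "Tgt D (Finv s) = on_obj F (Src C s)"
    "Finv s \<cdot>\<^bsub>D\<^esub> on_mor F s = Ident D (on_obj F (Src C s))"
    "on_mor F s \<cdot>\<^bsub>D\<^esub> Finv s = Ident D (on_obj F (Tgt C s))"
  using D.inv_mor_props[OF F_iso[OF assms]] assms by auto

lemma Finv_cancel [simp]:
  assumes "s \<in> S" "x \<in> Mor D"
  shows "Tgt D x = on_obj F (Tgt C s) \<Longrightarrow> on_mor F s \<cdot>\<^bsub>D\<^esub> (Finv s \<cdot>\<^bsub>D\<^esub> x) = x"
    and "Tgt D x = on_obj F (Src C s) \<Longrightarrow> Finv s \<cdot>\<^bsub>D\<^esub> (on_mor F s \<cdot>\<^bsub>D\<^esub> x) = x"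
  using D.inv_mor_cancel[OF F_iso[OF assms(1)] assms(2)] assms by auto

lemma Finv_unique:
  assumes "s \<in> S" "x \<in> Mor D" "Src D x = on_obj F (Tgt C s)" "Tgt D x = on_obj F (Src C s)"
    "on_mor F s \<cdot>\<^bsub>D\<^esub> x = Ident D (on_obj F (Tgt C s))"
  shows "x = Finv s"
  using assms by (intro D.inv_mor_unique F_iso) auto

text \<open>The left-hand side has the form that remains after \<open>F_Ident\<close> has rewritten
  the argument of \<open>Finv\<close>. \<open>Finv_Comp\<close> is likewise stated for the argument
  as expanded by \<open>F_Comp\<close>.\<close>

lemma Finv_Ident [simp]: "A \<in> Obj C \<Longrightarrow> D.inv_mor (Ident D (on_obj F A)) = Ident D (on_obj F A)"
  using Finv_unique[of "Ident C A" "Ident D (on_obj F A)"] by simp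

lemma Finv_Comp:
  assumes "s \<in> S" "t \<in> S" "Tgt C s = Src C t"
  shows "D.inv_mor (on_mor F t \<cdot>\<^bsub>D\<^esub> on_mor F s) = Finv s \<cdot>\<^bsub>D\<^esub> Finv t"
proof -
  have ts: "t \<cdot> s \<in> S" using assms by (intro S_Comp) simp_all
  have F: "on_mor F (t \<cdot> s) = on_mor F t \<cdot>\<^bsub>D\<^esub> on_mor F s" using assms by (simp add: F_Comp)
  have "Finv s \<cdot>\<^bsub>D\<^esub> Finv t = Finv (t \<cdot> s)"
    by (rule Finv_unique[OF ts]) (use assms in \<open>simp_all add: F D.Comp_assoc'\<close>)
  then show ?thesis by (simp only: F)
qed

text \<open>Apply \<open>F\<close> to \<open>f \<cdot> t' = t \<cdot> f'\<close>, then cancel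
  \<open>F t\<close> on the left and \<open>F t'\<close> on the right; \<open>t'\<close> is in
  \<open>S\<close> as a pullback of \<open>t\<close>. This is the exchange law behind
  multiplicativity of \<open>span_val\<close> and its invariance under a.\<close>

lemma Finv_pullback:
  assumes "is_pullback C f t t' f'" "t \<in> S"
  shows "Finv t \<cdot>\<^bsub>D\<^esub> on_mor F f = on_mor F f' \<cdot>\<^bsub>D\<^esub> Finv t'"
proof -
  note P = is_pullbackD[OF assms(1)]
  have t': "t' \<in> S" using assms pullback_in_S by blast
  have "Finv t \<cdot>\<^bsub>D\<^esub> on_mor F f = Finv t \<cdot>\<^bsub>D\<^esub> (on_mor F (f \<cdot> t') \<cdot>\<^bsub>D\<^esub> Finv t')"
    using P t' assms(2) unfolding F_Comp[OF P(3) P(1) P(7)[symmetric]] by (simp add: D.Comp_assoc')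
  also have "on_mor F (f \<cdot> t') = on_mor F t \<cdot>\<^bsub>D\<^esub> on_mor F f'"
    using P by (simp add: pullback_comm[OF assms(1)] F_Comp)
  also have "Finv t \<cdot>\<^bsub>D\<^esub> (\<dots> \<cdot>\<^bsub>D\<^esub> Finv t') = on_mor F f' \<cdot>\<^bsub>D\<^esub> Finv t'"
    using P t' assms(2) by (simp add: D.Comp_assoc')
  finally show ?thesis .
qed

section \<open>Values of spans under an inverting functor\<close>

definition span_val :: "'m \<times> 'm \<Rightarrow> 'q" where
  "span_val u = on_mor F (snd u) \<cdot>\<^bsub>D\<^esub> Finv (fst u)"

lemma span_val_Hom:
  assumes "u \<in> Spans C S"
  shows "span_val u \<in> Hom D (on_obj F (span_src C u)) (on_obj F (span_tgt C u))"
  using assms by (cases u) (auto simp: span_val_def span_src_def span_tgt_def Hom_def)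

text \<open>In the product of the two values the inner factor is \<open>Finv t\<close> after
  \<open>F f\<close>. \<open>Finv_pullback\<close> replaces it by the two legs of the
  pullback.\<close>

lemma span_val_hcomp:
  assumes "u \<in> Spans C S" "v \<in> Spans C S" "p \<in> hcomp C v u"
  shows "span_val p = span_val v \<cdot>\<^bsub>D\<^esub> span_val u"
proof -
  obtain s f t g where [simp]: "u = (s, f)" "v = (t, g)" by (cases u, cases v)
  obtain t' f' where pb: "is_pullback C f t t' f'" and p: "p = (s \<cdot> t', g \<cdot> f')"
    using assms by auto
  note P = is_pullbackD[OF pb]
  have t': "t' \<in> S" using pb assms by (auto intro: pullback_in_S)
  have "span_val p = on_mor F g \<cdot>\<^bsub>D\<^esub> ((on_mor F f' \<cdot>\<^bsub>D\<^esub> Finv t') \<cdot>\<^bsub>D\<^esub> Finv s)"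
    using P t' assms(1,2) by (simp add: span_val_def p F_Comp Finv_Comp D.Comp_assoc')
  also have "\<dots> = on_mor F g \<cdot>\<^bsub>D\<^esub> ((Finv t \<cdot>\<^bsub>D\<^esub> on_mor F f) \<cdot>\<^bsub>D\<^esub> Finv s)"
    using Finv_pullback[OF pb] assms by simp
  also have "\<dots> = span_val v \<cdot>\<^bsub>D\<^esub> span_val u"
    using P t' assms(1,2) by (simp add: span_val_def D.Comp_assoc')
  finally show ?thesis .
qed

lemma span_val_le:
  assumes "(u, v) \<in> span_le C S"
  shows "span_val u = span_val v"
proof -
  obtain s f x where "u = (s \<cdot> x, f \<cdot> x)" "v = (s, f)" "s \<in> S" "f \<in> Mor C" "Src C s = Src C f"
    "x \<in> S" "Tgt C x = Src C s"
    using assms by (auto elim: span_leE)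
  then show ?thesis by (simp add: span_val_def F_Comp Finv_Comp D.Comp_assoc')
qed

text \<open>By \<open>Finv_pullback\<close>, the value of a pullback span can be computed from its
  cospan as \<open>Finv s\<close> after \<open>F f\<close>. There a common factor \<open>F v\<close>
  cancels.\<close>

lemma span_val_pb_cospan_le:
  assumes "(c, d) \<in> cospan_le C S" "p \<in> pb C c" "q \<in> pb C d"
  shows "span_val p = span_val q"
proof -
  obtain f s v where c: "c = (f, s)" and d: "d = (v \<cdot> f, v \<cdot> s)"
    and fs: "f \<in> Mor C" "s \<in> S" "Tgt C f = Tgt C s" "v \<in> S" "Src C v = Tgt C f"
    using cospan_leE[OF assms(1)] by blast
  have vs: "v \<cdot> s \<in> S" using fs by (intro S_Comp) simp_all
  obtain s1 f1 s2 f2 where p: "p = (s1, f1)" and q: "q = (s2, f2)" by (cases p, cases q)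
  have 1: "is_pullback C f s s1 f1" and 2: "is_pullback C (v \<cdot> f) (v \<cdot> s) s2 f2"
    using assms(2,3) by (simp_all add: c d p q)
  have "span_val p = Finv s \<cdot>\<^bsub>D\<^esub> on_mor F f"
    using Finv_pullback[OF 1 fs(2)] by (simp add: span_val_def p)
  also have "\<dots> = Finv (v \<cdot> s) \<cdot>\<^bsub>D\<^esub> on_mor F (v \<cdot> f)"
    using fs by (simp add: F_Comp Finv_Comp D.Comp_assoc')
  also have "\<dots> = span_val q"
    using Finv_pullback[OF 2 vs] by (simp add: span_val_def q)
  finally show ?thesis .
qed

lemma span_val_az:
  assumes "(u, v) \<in> sim_az C S"
  shows "span_val u = span_val v"
proof -
  \<comment> \<open>The restriction to parallel spans is what compatibility demands; closure under
    composition then follows from \<open>span_val_hcomp\<close>.\<close>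
  define K where "K = {(u, v) \<in> parallel_spans C S. span_val u = span_val v}"
  have "equiv (Spans C S) K"
    using equiv_parallel by (auto simp: K_def equiv_def refl_on_def sym_def trans_def parallel_spans_def)
  moreover have le: "span_le C S \<subseteq> K"
    unfolding K_def using span_val_le span_le_parallel by blast
  moreover have "approx_a C S \<subseteq> K"
  proof -
    have "compatible C S K"
    proof (rule compatibleI)
      show "span_iso C S \<subseteq> K" using le span_iso_le by blast
      show "K \<subseteq> parallel_spans C S" by (auto simp: K_def)
      fix u v w p q assume uv: "(u, v) \<in> K" and w: "w \<in> Spans C S"
      then have par: "(u, v) \<in> parallel_spans C S" and val: "span_val u = span_val v"
        by (auto simp: K_def)
      note Sp = parallel_spansD(1,2)[OF par]
      show "(p, q) \<in> K" if "p \<in> hcomp C w u" "q \<in> hcomp C w v"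
        using parallel_hcomp(1)[OF par w that] val
          span_val_hcomp[OF Sp(1) w that(1)] span_val_hcomp[OF Sp(2) w that(2)]
        by (simp add: K_def)
      show "(p, q) \<in> K" if "p \<in> hcomp C u w" "q \<in> hcomp C v w"
        using parallel_hcomp(2)[OF par w that] val
          span_val_hcomp[OF w Sp(1) that(1)] span_val_hcomp[OF w Sp(2) that(2)]
        by (simp add: K_def)
    qed
    moreover have "pb C c \<times> pb C d \<subseteq> K" if "(c, d) \<in> cospan_le C S" for c d
      using pb_parallel[OF that] span_val_pb_cospan_le[OF that] unfolding K_def by blast
    ultimately show ?thesis by (rule approx_a_min)
  qed
  ultimately have "sim_az C S \<subseteq> K" by (rule sim_az_min)
  then show ?thesis using assms by (auto simp: K_def)
qed

section \<open>The induced functor and its uniqueness\<close>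

definition factor :: "('o, ('m \<times> 'm) set, 'p, 'q) func" where
  "factor = \<lparr>on_obj = on_obj F, on_mor = (\<lambda>X. span_val (SOME u. u \<in> X))\<rparr>"

lemma factor_obj [simp]: "on_obj factor A = on_obj F A"
  by (simp add: factor_def)

text \<open>The representative picked in \<open>factor\<close> is az-related to \<open>u\<close>,
  and \<open>span_val_az\<close> makes the value independent of it.\<close>

lemma factor_class:
  assumes "u \<in> Spans C S"
  shows "on_mor factor (az_class u) = span_val u"
proof -
  have "(u, SOME v. v \<in> az_class u) \<in> sim_az C S"
    using someI[of "\<lambda>v. v \<in> az_class u" u] equiv_az assms by (auto simp: equiv_def refl_on_def)
  then show ?thesis using span_val_az by (auto simp: factor_def)
qed

lemma is_functor_factor: "is_functor (Span_az C S) D factor"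
  unfolding is_functor_def
proof (intro conjI ballI impI)
  show "on_obj factor A \<in> Obj D" if "A \<in> Obj (Span_az C S)" for A
    using that by simp
  show "on_mor factor X \<in> Hom D (on_obj factor (Src (Span_az C S) X)) (on_obj factor (Tgt (Span_az C S) X))"
    if "X \<in> Mor (Span_az C S)" for X
    using that span_val_Hom by (auto simp: Mor_class_az Src_class_az Tgt_class_az factor_class)
  show "on_mor factor (Ident (Span_az C S) A) = Ident D (on_obj factor A)"
    if "A \<in> Obj (Span_az C S)" for A
    using that by (simp add: Ident_az factor_class span_val_def)
  show "on_mor factor (Comp (Span_az C S) Y X) = on_mor factor Y \<cdot>\<^bsub>D\<^esub> on_mor factor X"
    if XY: "X \<in> Mor (Span_az C S)" "Y \<in> Mor (Span_az C S)" "Src (Span_az C S) Y = Tgt (Span_az C S) X" for X Y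
  proof -
    obtain u v where u: "u \<in> Spans C S" "X = az_class u" and v: "v \<in> Spans C S" "Y = az_class v"
      using XY by (auto simp: Mor_class_az)
    obtain p where p: "p \<in> hcomp C v u"
      using hcomp_exists[OF u(1) v(1)] XY u v by (auto simp: Src_class_az Tgt_class_az)
    show ?thesis
      using u v p hcomp_Spans(1)[OF u(1) v(1) p]
      by (simp add: Comp_class_az factor_class span_val_hcomp)
  qed
qed

lemma func_eq_factor: "func_eq C (func_comp factor (Phi_az C S)) F"
  by (auto simp: func_eq_def func_comp_def Phi_az_mor Phi_az_obj factor_class span_val_def)

lemma factor_unique:
  assumes G: "is_functor (Span_az C S) D G" and eq: "func_eq C (func_comp G (Phi_az C S)) F"
  shows "func_eq (Span_az C S) G factor"
  unfolding func_eq_def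
proof (intro conjI ballI)
  have obj: "on_obj G A = on_obj F A" if "A \<in> Obj C" for A
    using eq that by (simp add: func_eq_def func_comp_def Phi_az_obj)
  then show "on_obj G A = on_obj factor A" if "A \<in> Obj (Span_az C S)" for A
    using that by simp
  have mor: "on_mor G (az_class (Ident C (Src C f), f)) = on_mor F f" if "f \<in> Mor C" for f
    using eq that by (simp add: func_eq_def func_comp_def Phi_az_mor)
  have G_Comp: "on_mor G (Comp (Span_az C S) (az_class v) (az_class u))
      = on_mor G (az_class v) \<cdot>\<^bsub>D\<^esub> on_mor G (az_class u)"
    if "u \<in> Spans C S" "v \<in> Spans C S" "span_tgt C u = span_src C v" for u v
  proof -
    have "az_class u \<in> Mor (Span_az C S)" "az_class v \<in> Mor (Span_az C S)"
      using that by (auto simp: Mor_class_az)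
    then show ?thesis
      using G that unfolding is_functor_def by (simp add: Src_class_az Tgt_class_az)
  qed
  have G_Hom: "on_mor G (az_class u) \<in> Hom D (on_obj F (span_src C u)) (on_obj F (span_tgt C u))"
    if "u \<in> Spans C S" for u
  proof -
    have "span_src C u \<in> Obj C" "span_tgt C u \<in> Obj C"
      using that by (cases u; auto simp: span_src_def span_tgt_def)+
    moreover have "az_class u \<in> Mor (Span_az C S)" using that by (auto simp: Mor_class_az)
    ultimately show ?thesis
      using G that unfolding is_functor_def by (auto simp: Src_class_az Tgt_class_az obj)
  qed
  fix X assume "X \<in> Mor (Span_az C S)"
  then obtain s f where sf: "s \<in> S" "f \<in> Mor C" "Src C s = Src C f" and X: "X = az_class (s, f)"
    by (auto simp: Mor_class_az)
  define i where "i = Ident C (Src C s)"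
  have i: "(i, s) \<in> Spans C S" "(s, i) \<in> Spans C S" "(i, f) \<in> Spans C S"
    using sf by (auto simp: i_def)
  \<comment> \<open>\<open>G\<close> sends the class of \<open>(i, s)\<close> to \<open>F s\<close>,
    so the class of \<open>(s, i)\<close> goes to a right inverse of \<open>F s\<close>. Since
    \<open>F s\<close> is invertible, this value must be \<open>Finv s\<close>.\<close>
  have "on_mor F s \<cdot>\<^bsub>D\<^esub> on_mor G (az_class (s, i)) = on_mor G (Ident (Span_az C S) (Tgt C s))"
    using G_Comp[OF i(2) i(1)] az_class_inverse(1)[OF sf(1)] mor[of s] sf
    by (simp add: i_def span_src_def span_tgt_def)
  also have "\<dots> = Ident D (on_obj F (Tgt C s))"
    using G sf by (simp add: is_functor_def obj)
  finally have inv: "on_mor G (az_class (s, i)) = Finv s"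
    using G_Hom[OF i(2)] sf by (intro Finv_unique) (auto simp: Hom_def span_src_def span_tgt_def i_def)
  have pb: "is_pullback C i i i i"
    using pullback_Ident_left[of i "Src C s" "Src C s"] sf by (auto simp: i_def)
  \<comment> \<open>Every span factors as its backward part \<open>(s, i)\<close> followed by its
    forward part \<open>(i, f)\<close>, and \<open>G\<close> is already known on both.\<close>
  have "(s, f) \<in> hcomp C (i, f) (s, i)"
    using sf by (intro hcompI[OF pb]) (auto simp: i_def)
  then have "X = Comp (Span_az C S) (az_class (i, f)) (az_class (s, i))"
    using i by (simp add: Comp_class_az X del: hcomp.simps)
  then have "on_mor G X = on_mor F f \<cdot>\<^bsub>D\<^esub> Finv s"
    using G_Comp[OF i(2) i(3)] mor[of f] sf inv by (simp add: i_def span_src_def span_tgt_def)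
  then show "on_mor G X = on_mor factor X"
    using sf by (simp add: X factor_class span_val_def)
qed

lemma factors_uniquely_Phi_az: "factors_uniquely C (Span_az C S) (Phi_az C S) D F"
  unfolding factors_uniquely_def
  using is_functor_factor func_eq_factor factor_unique by blast

end

theorem theorem3:
  fixes C :: "('o, 'm) cat" and S :: "'m set"
  assumes "span_setting C S"
  shows "category (Span_az C S) \<and>
         is_functor C (Span_az C S) (Phi_az C S) \<and>
         inverts S (Span_az C S) (Phi_az C S) \<and>
         (\<forall>(D :: ('p, 'q) cat) F.
            category D \<and> is_functor C D F \<and> inverts S D F \<longrightarrow>
            factors_uniquely C (Span_az C S) (Phi_az C S) D F)"
proof -
  interpret span_setting C S by fact
  have "factors_uniquely C (Span_az C S) (Phi_az C S) D F"
    if "category D" "is_functor C D F" "inverts S D F" for D :: "('p, 'q) cat" and F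
  proof -
    interpret D: category D by fact
    interpret inverting_functor C S D F by unfold_locales fact+
    show ?thesis by (rule factors_uniquely_Phi_az)
  qed
  then show ?thesis
    using category_Span_az is_functor_Phi_az inverts_Phi_az by blast
qed

end
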